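(* Let $K\ge 1$ and $1\le k\le K$ be integers, and let $(A,b,c)$ with $A\in\mathbb{R}^{K\times K}$ and $b,c^{\mathsf T}\in\mathbb{R}^{K}$ be a realization of a transfer function $G(z)$ such that $A$ is $k$-positive. Then: (i) If $\mathcal{C}^j(A,b)_{[j]}\ge 0$ for all $1\le j\le k$ and $\mathrm{rank}(A^{K-j}\mathcal{C}^j(A,b))=j$ for all $1\le j\le k-1$, then $\mathcal{C}^t(A,b)$ is $k$-positive for all $t\ge k$. (ii) If $\mathcal{O}^j(A,c)_{[j]}\ge 0$ for all $1\le j\le k$ and $\mathrm{rank}(\mathcal{O}^j(A,c)A^{K-j})=j$ for all $1\le j\le k-1$, then $\mathcal{O}^t(A,c)$ is $k$-positive for all $t\ge k$. Moreover, the rank conditions in (i) and (ii) are fulfilled if $k$ does not exceed the order of the system $G(z)$ and $p_{k-1}>0$ (the condition on $p_{k-1}$ being void for $k=1$).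
   Context: Matrix inequalities $\ge 0$, $>0$ are entrywise. For $X\in\mathbb{R}^{n\times m}$ and $1\le r\le\min\{n,m\}$, the $r$-th multiplicative compound matrix $X_{[r]}\in\mathbb{R}^{\binom nr\times\binom mr}$ has as entries all $r\times r$ minors $\det(X_{I,J})$, where $I\subseteq\{1,\dots,n\}$ and $J\subseteq\{1,\dots,m\}$ range over the $r$-element subsets in lexicographic order. For $k\le\min\{n,m\}$, $X$ is $k$-positive if $X_{[j]}\ge 0$ for all $1\le j\le k$. For a square matrix $A$, a column vector $b$ and a row vector $c$ of matching size, $$\mathcal{C}^j(A,b)=\begin{pmatrix} b & Ab & \cdots & A^{j-1}b\end{pmatrix},\qquad \mathcal{O}^j(A,c)=\mathcal{C}^j(A^{\mathsf T},c^{\mathsf T})^{\mathsf T},$$ i.e. $\mathcal{O}^j(A,c)$ has rows $c,cA,\dots,cA^{j-1}$. A triple $(A,b,c)$ is a (discrete-time, single-input single-output) realization of $G(z)$ if $A$ is stable (all eigenvalues in the open unit disc) and $G(z)=c(zI-A)^{-1}b$, i.e. $G(z)=\sum_{t\ge1}g(t)z^{-t}$ with $g(t)=cA^{t-1}b$ for $t\ge1$. It is not assumed to be minimal. Write $G(z)=r\prod_{i=1}^m(z-z_i)/\prod_{i=1}^n(z-p_i)$ with $m<n$ and with the poles $p_i$ disjoint from the zeros $z_i$; the order of the system is the number $n$ of poles (with multiplicity). The poles are sorted by descending absolute value $|p_1|\ge|p_2|\ge\dots$, ties being sorted by decreasing real part. *)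

theory Defs
  imports
    "Jordan_Normal_Form.DL_Submatrix"
    "Jordan_Normal_Form.DL_Rank"
    "Jordan_Normal_Form.Gauss_Jordan_Elimination"
    "Jordan_Normal_Form.Spectral_Radius"
begin

text \<open>Vectors and matrices are indexed from 0.  Row and column vectors are both of type
  \<open>'a vec\<close>; the product of a row vector with a column vector is the scalar product.\<close>

definition nonneg_mat :: "real mat \<Rightarrow> bool" where
  "nonneg_mat X \<longleftrightarrow> 0\<^sub>m (dim_row X) (dim_col X) \<le> X"

text \<open>The \<open>r\<close>-element subsets of \<open>{0..<n}\<close>, as increasing lists.  For lists of one fixed length
  the order in which \<open>subseqs\<close> enumerates (sublists containing the head first) is the
  lexicographic one, e.g. \<open>[[0,1],[0,2],[1,2]]\<close> for \<open>n = 3\<close>, \<open>r = 2\<close>.\<close>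

definition lex_subsets :: "nat \<Rightarrow> nat \<Rightarrow> nat list list" where
  "lex_subsets n r = filter (\<lambda>xs. length xs = r) (subseqs [0..<n])"

lemma length_filter_subseqs:
  "length (filter (\<lambda>ys. length ys = r) (subseqs xs)) = length xs choose r"
proof (induction xs arbitrary: r)
  case Nil
  then show ?case by (cases r) auto
next
  case (Cons x xs)
  then show ?case using Cons.IH[of 0]
    by (cases r) (simp_all add: Let_def filter_map o_def)
qed

lemma length_lex_subsets: "length (lex_subsets n r) = n choose r"
  by (simp add: lex_subsets_def length_filter_subseqs)

lemma set_lex_subsets: "set ` set (lex_subsets n r) = {I. I \<subseteq> {0..<n} \<and> card I = r}"
proof -
  have len: "length ys = card (set ys)" if "ys \<in> set (subseqs [0..<n])" for ys
    using that subseqs_distinctD[of ys "[0..<n]"] distinct_card[of ys] by simp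
  have pow: "set ` set (subseqs [0..<n]) = Pow {0..<n}"
    using subseqs_powset[of "[0..<n]"] by simp
  have "set ` set (lex_subsets n r) = {I \<in> set ` set (subseqs [0..<n]). card I = r}"
    unfolding lex_subsets_def set_filter using len by force
  then show ?thesis
    unfolding pow by auto
qed

definition compound_mat :: "nat \<Rightarrow> 'a :: comm_ring_1 mat \<Rightarrow> 'a mat" where
  "compound_mat r X = mat (dim_row X choose r) (dim_col X choose r)
     (\<lambda>(i, j). det (submatrix X (set (lex_subsets (dim_row X) r ! i))
                                (set (lex_subsets (dim_col X) r ! j))))"

definition k_positive :: "nat \<Rightarrow> real mat \<Rightarrow> bool" where
  "k_positive k X \<longleftrightarrow> k \<le> min (dim_row X) (dim_col X) \<and>
     (\<forall>j\<in>{1..k}. nonneg_mat (compound_mat j X))"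

definition ctrb_mat :: "nat \<Rightarrow> 'a :: semiring_1 mat \<Rightarrow> 'a vec \<Rightarrow> 'a mat" where
  "ctrb_mat j A b = mat_of_cols (dim_row A) (map (\<lambda>i. (A ^\<^sub>m i) *\<^sub>v b) [0..<j])"

definition obsv_mat :: "nat \<Rightarrow> 'a :: semiring_1 mat \<Rightarrow> 'a vec \<Rightarrow> 'a mat" where
  "obsv_mat j A c = transpose_mat (ctrb_mat j (transpose_mat A) c)"

definition stable_mat :: "real mat \<Rightarrow> bool" where
  "stable_mat A \<longleftrightarrow> (\<forall>p. eigenvalue (map_mat complex_of_real A) p \<longrightarrow> cmod p < 1)"

text \<open>A transfer function is represented by a complex function.  The resolvent formula is
  required wherever the resolvent exists.\<close>

definition realization :: "nat \<Rightarrow> real mat \<Rightarrow> real vec \<Rightarrow> real vec \<Rightarrow> (complex \<Rightarrow> complex) \<Rightarrow> bool" where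
  "realization n A b c G \<longleftrightarrow>
     A \<in> carrier_mat n n \<and> b \<in> carrier_vec n \<and> c \<in> carrier_vec n \<and> stable_mat A \<and>
     (\<forall>z. \<not> eigenvalue (map_mat complex_of_real A) z \<longrightarrow>
        G z = map_vec complex_of_real c \<bullet>
          (the (mat_inverse (z \<cdot>\<^sub>m 1\<^sub>m n - map_mat complex_of_real A)) *\<^sub>v map_vec complex_of_real b))"

text \<open>\<open>G\<close> has gain \<open>r\<close>, zeros \<open>zs\<close> and poles \<open>ps\<close> (listed with multiplicity, poles in the
  prescribed order), so the order of the system is \<open>length ps\<close>.  Equality of rational functions
  is equality up to finitely many points, so that values of \<open>G\<close> at poles and at removable
  singularities are irrelevant.  The condition \<open>r \<noteq> 0\<close> only excludes the zero function, for which
  the lists would be arbitrary; it has no poles.\<close>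

definition pole_zero_form ::
    "(complex \<Rightarrow> complex) \<Rightarrow> complex \<Rightarrow> complex list \<Rightarrow> complex list \<Rightarrow> bool" where
  "pole_zero_form G r zs ps \<longleftrightarrow>
     r \<noteq> 0 \<and> length zs < length ps \<and> set ps \<inter> set zs = {} \<and>
     finite {z. G z \<noteq> r * (\<Prod>a\<leftarrow>zs. z - a) / (\<Prod>p\<leftarrow>ps. z - p)} \<and>
     sorted_wrt (\<lambda>p q. cmod q < cmod p \<or> (cmod q = cmod p \<and> Re q \<le> Re p)) ps"

end

theory Submission
  imports Defs "Jordan_Normal_Form.DL_Rank_Submatrix"
begin

text \<open>Write \<open>v\<^sub>l = A\<^sup>l b\<close>.  Since \<open>v\<^sub>l\<^sub>+\<^sub>1 = A v\<^sub>l\<close>, Cauchy--Binet and the nonnegativity of the compounds of \<open>A\<close>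
  propagate the hypothesis on the first \<open>j\<close> columns to all windows \<open>v\<^sub>i, \<dots>, v\<^sub>i\<^sub>+\<^sub>j\<^sub>-\<^sub>1\<close>.  Passing from windows to
  arbitrary columns is Fekete's argument: a three-term determinantal identity expresses a minor with a gap
  by minors of smaller spread, after division by a positive minor of order \<open>j - 1\<close>.  Strict positivity is
  obtained by multiplying from the left with a strictly totally positive Gaussian matrix tending to the
  identity, which makes every minor positive whose columns are independent.

  Windows need not stay independent, for the nilpotent part of \<open>A\<close> dies out.  Let \<open>z\<^sup>s q(z)\<close> with \<open>q(0) \<noteq> 0\<close> be the
  minimal annihilating polynomial of \<open>b\<close>, and let \<open>d = deg q\<close>.  From index \<open>K - d \<ge> s\<close> on the columns span a
  space of dimension at most \<open>d\<close>.  So minors with more than \<open>d\<close> columns from there on vanish, while the rank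
  condition makes the remaining windows of order less than \<open>k\<close> independent; Fekete's argument is run on the
  column sets with at most \<open>d\<close> columns of index at least \<open>K - d\<close>.

  For the last claim, if \<open>z\<^sup>i p(z)\<close> annihilates \<open>b\<close> then its product with \<open>G\<close> is a polynomial, so all poles are
  among its roots.  The first \<open>k - 1\<close> poles are nonzero, hence roots of \<open>p\<close>, which forces
  \<open>deg p \<ge> k - 1\<close> or \<open>p = 0\<close>.\<close>

section \<open>Minors along lists of rows and columns\<close>

text \<open>Matrices are functions here, so that column indices range over all naturals. Index lists
  may repeat entries or come in any order, as the expansions below produce them; the size is taken
  from \<open>rs\<close>.\<close>

definition minor :: "(nat \<Rightarrow> nat \<Rightarrow> 'a :: comm_ring_1) \<Rightarrow> nat list \<Rightarrow> nat list \<Rightarrow> 'a" where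
  "minor X rs cs = det (mat (length rs) (length rs) (\<lambda>(a, b). X (rs ! a) (cs ! b)))"

definition incr_lists :: "nat \<Rightarrow> nat \<Rightarrow> nat list set" where
  "incr_lists n j = {xs. sorted_wrt (<) xs \<and> set xs \<subseteq> {..<n} \<and> length xs = j}"

lemma finite_incr_lists: "finite (incr_lists n j)"
  by (rule finite_subset[OF _ finite_lists_length_eq[of "{..<n}" j]]) (auto simp: incr_lists_def)

lemma minor_Nil [simp]: "minor X [] cs = 1"
  by (simp add: minor_def)

lemma minor_cong:
  assumes "length rs' = length rs" "length cs = length rs"  "length cs' = length rs"
    and "\<And>a b. a < length rs \<Longrightarrow> b < length rs \<Longrightarrow> X (rs ! a) (cs ! b) = Y (rs' ! a) (cs' ! b)"
  shows "minor X rs cs = minor Y rs' cs'"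
  unfolding minor_def using assms by (intro arg_cong[of _ _ det] eq_matI) auto

lemma minor_transpose:
  assumes "length cs = length rs"
  shows "minor (\<lambda>a b. X b a) cs rs = minor X rs cs"
proof -
  have "mat (length rs) (length rs) (\<lambda>(a, b). X (rs ! a) (cs ! b)) =
      transpose_mat (mat (length rs) (length rs) (\<lambda>(a, b). X (rs ! b) (cs ! a)))"
    by (rule eq_matI) auto
  then show ?thesis
    unfolding minor_def assms by (simp add: det_transpose[of _ "length rs"])
qed

text \<open>The scaled matrix factors as diagonal times original times diagonal.\<close>

lemma minor_scale:
  assumes "length cs = length rs"
  shows "minor (\<lambda>r c. f r * g c * X r c) rs cs =
    (\<Prod>r\<leftarrow>rs. f r) * (\<Prod>c\<leftarrow>cs. g c) * minor X rs cs"
proof -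
  let ?n = "length rs"
  let ?D = "mat ?n ?n (\<lambda>(a, b). if a = b then f (rs ! a) else 0)"
  let ?E = "mat ?n ?n (\<lambda>(a, b). if a = b then g (cs ! a) else 0)"
  let ?X = "mat ?n ?n (\<lambda>(a, b). X (rs ! a) (cs ! b))"
  have eq: "mat ?n ?n (\<lambda>(a, b). f (rs ! a) * g (cs ! b) * X (rs ! a) (cs ! b)) = ?D * (?X * ?E)"
    by (rule eq_matI) (auto simp: scalar_prod_def if_distrib if_distribR sum.delta cong: if_cong)
  have "det ?D = (\<Prod>r\<leftarrow>rs. f r)" "det ?E = (\<Prod>c\<leftarrow>cs. g c)"
    using assms by (auto simp: det_upper_triangular[of _ ?n] upper_triangular_def diag_mat_def comp_def
        intro!: arg_cong[of _ _ prod_list] nth_equalityI)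
  then show ?thesis
    unfolding minor_def eq
    by (simp add: det_mult[of ?D ?n "?X * ?E"] det_mult[of ?X ?n ?E] mult_carrier_mat[of ?X ?n ?n ?E ?n]
        mult.assoc mult.left_commute)
qed

lemma minor_eq_rows:
  assumes "\<not> distinct rs"
  shows "minor X rs cs = 0"
proof -
  from assms obtain a b where ab: "a < length rs" "b < length rs" "a \<noteq> b" "rs ! a = rs ! b"
    by (auto simp: distinct_conv_nth)
  show ?thesis unfolding minor_def
    by (rule det_identical_rows[OF _ ab(3) ab(1) ab(2)]) (use ab in auto)
qed

lemma minor_eq_cols:
  assumes "\<not> distinct cs" "length cs = length rs"
  shows "minor X rs cs = 0"
  using minor_eq_rows[OF assms(1), of "\<lambda>a b. X b a" rs] minor_transpose[OF assms(2), of X] by simp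

lemma minor_dependent_cols:
  fixes X :: "nat \<Rightarrow> nat \<Rightarrow> 'a :: field"
  assumes "length cs = length rs" "a < length rs" "x a \<noteq> 0"
    and "\<And>r. r \<in> set rs \<Longrightarrow> (\<Sum>a<length rs. X r (cs ! a) * x a) = 0"
  shows "minor X rs cs = 0"
proof -
  let ?n = "length rs"
  let ?M = "mat ?n ?n (\<lambda>(a, b). X (rs ! a) (cs ! b))"
  have "?M *\<^sub>v vec ?n x = 0\<^sub>v ?n"
    using assms(4) by (intro eq_vecI) (auto simp: scalar_prod_def lessThan_atLeast0)
  moreover have "vec ?n x \<noteq> 0\<^sub>v ?n"
    using assms(2,3) by (auto simp: vec_eq_iff)
  ultimately show ?thesis
    unfolding minor_def using det_0_iff_vec_prod_zero_field[of ?M ?n] by force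
qed

lemma minor_nonzero_kernel:
  fixes X :: "nat \<Rightarrow> nat \<Rightarrow> 'a :: field"
  assumes "length cs = length rs" 
    and "\<And>x. \<lbrakk>\<And>r. r \<in> set rs \<Longrightarrow> (\<Sum>a<length rs. X r (cs ! a) * x a) = 0\<rbrakk> \<Longrightarrow> \<forall>a<length rs. x a = 0"
  shows "minor X rs cs \<noteq> 0"
proof
  let ?n = "length rs"
  let ?M = "mat ?n ?n (\<lambda>(a, b). X (rs ! a) (cs ! b))"
  assume "minor X rs cs = 0"
  then obtain v where v: "v \<in> carrier_vec ?n" "v \<noteq> 0\<^sub>v ?n" "?M *\<^sub>v v = 0\<^sub>v ?n"
    unfolding minor_def using det_0_iff_vec_prod_zero_field[of ?M ?n] by auto
  have "(\<Sum>a<?n. X r (cs ! a) * v $ a) = 0" if "r \<in> set rs" for r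
  proof -
    from that obtain i where i: "i < ?n" "r = rs ! i" by (auto simp: in_set_conv_nth)
    have "(?M *\<^sub>v v) $ i = 0" using v(3) i by simp
    then show ?thesis using i v(1) by (simp add: scalar_prod_def lessThan_atLeast0)
  qed
  from assms(2)[OF this] v(1,2) show False by (auto simp: vec_eq_iff)
qed

text \<open>Laplace expansion; splitting the column list at \<open>c\<close> records the position of
  that column, hence the sign, as \<open>length xs\<close>.\<close>

lemma minor_expand_col:
  assumes "length rs = Suc (length xs + length ys)"
  shows "minor X rs (xs @ c # ys) =
    (\<Sum>a<length rs. (-1) ^ (a + length xs) * X (rs ! a) c *
       minor X (take a rs @ drop (Suc a) rs) (xs @ ys))"
proof -
  let ?n = "length rs"
  let ?M = "mat ?n ?n (\<lambda>(a, b). X (rs ! a) ((xs @ c # ys) ! b))"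
  have "det ?M = (\<Sum>a<?n. ?M $$ (a, length xs) * cofactor ?M a (length xs))"
    by (rule laplace_expansion_column) (use assms in auto)
  also have "\<dots> = (\<Sum>a<?n. (-1) ^ (a + length xs) * X (rs ! a) c *
       minor X (take a rs @ drop (Suc a) rs) (xs @ ys))"
  proof (rule sum.cong[OF refl], goal_cases)
    case (1 a)
    then have a: "a < ?n" by simp
    have "det (mat_delete ?M a (length xs)) = minor X (take a rs @ drop (Suc a) rs) (xs @ ys)"
      unfolding minor_def mat_delete_def using a assms
      by (intro arg_cong[of _ _ det] eq_matI) (auto simp: nth_append min_def)
    then show ?case using a assms by (simp add: cofactor_def nth_append)
  qed
  finally show ?thesis by (simp add: minor_def)
qed

lemma minor_expand_row:
  assumes "length cs = Suc (length rs)"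
  shows "minor X (r # rs) cs =
    (\<Sum>b<length cs. (-1) ^ b * X r (cs ! b) * minor X rs (take b cs @ drop (Suc b) cs))"
proof -
  have "minor X (r # rs) cs = minor (\<lambda>a b. X b a) cs ([] @ r # rs)"
    using minor_transpose[of cs "r # rs" X] assms by simp
  also have "\<dots> = (\<Sum>b<length cs. (-1) ^ b * X r (cs ! b) *
      minor (\<lambda>a b. X b a) (take b cs @ drop (Suc b) cs) rs)"
    by (subst minor_expand_col) (use assms in auto)
  also have "\<dots> = (\<Sum>b<length cs. (-1) ^ b * X r (cs ! b) * minor X rs (take b cs @ drop (Suc b) cs))"
    by (intro sum.cong refl arg_cong2[of _ _ _ _ "(*)"] minor_transpose) (use assms in auto)
  finally show ?thesis .
qed

section \<open>Cauchy--Binet and a three-term identity\<close>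

text \<open>First half of Cauchy--Binet: every row of the product is a combination of rows of
  \<open>B\<close>, so multilinearity in the rows gives a sum over all lists \<open>w\<close>, with
  repetitions and in every order.\<close>

lemma minor_mult_lists:
  fixes A B :: "nat \<Rightarrow> nat \<Rightarrow> 'a :: comm_ring_1"
  assumes "length cs = length rs"
  shows "minor (\<lambda>r c. \<Sum>m<n. A r m * B m c) rs cs =
    (\<Sum>w | set w \<subseteq> {..<n} \<and> length w = length rs. prod_list (map2 A rs w) * minor B w cs)"
  using assms
proof (induction rs arbitrary: cs)
  case Nil
  have "{w. set w \<subseteq> {..<n} \<and> length w = length ([] :: nat list)} = {[]}"
    by auto
  then show ?case by simp
next
  case (Cons r rs)
  let ?W = "{w. set w \<subseteq> {..<n} \<and> length w = length rs}"
  let ?del = "\<lambda>b. take b cs @ drop (Suc b) cs"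
  have W: "{w. set w \<subseteq> {..<n} \<and> length w = length (r # rs)} = (\<lambda>(m, w). m # w) ` ({..<n} \<times> ?W)"
    by (auto simp: length_Suc_conv image_iff)
  have inj: "inj_on (\<lambda>(m, w). m # w) ({..<n} \<times> ?W)"
    by (auto simp: inj_on_def)
  have "minor (\<lambda>r c. \<Sum>m<n. A r m * B m c) (r # rs) cs =
      (\<Sum>b<length cs. (-1) ^ b * ((\<Sum>m<n. A r m * B m (cs ! b)) *
        (\<Sum>w\<in>?W. prod_list (map2 A rs w) * minor B w (?del b))))"
    unfolding minor_expand_row[of cs rs, OF Cons.prems[simplified]]
    by (intro sum.cong refl) (use Cons.prems Cons.IH in \<open>simp add: mult.assoc\<close>)
  also have "\<dots> = (\<Sum>b<length cs. \<Sum>m<n. \<Sum>w\<in>?W.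
      (A r m * prod_list (map2 A rs w)) * ((-1) ^ b * B m (cs ! b) * minor B w (?del b)))"
    by (subst sum_product) (simp add: sum_distrib_left sum_distrib_right mult_ac)
  also have "\<dots> = (\<Sum>m<n. \<Sum>w\<in>?W. \<Sum>b<length cs.
      (A r m * prod_list (map2 A rs w)) * ((-1) ^ b * B m (cs ! b) * minor B w (?del b)))"
    by (subst sum.swap, intro sum.cong refl sum.swap)
  \<comment> \<open>For fixed \<open>m\<close> and \<open>w\<close>, the alternating sum over
    \<open>b\<close> is the expansion of \<open>minor B (m # w) cs\<close> along its first
    row.\<close>
  also have "\<dots> = (\<Sum>m<n. \<Sum>w\<in>?W. prod_list (map2 A (r # rs) (m # w)) * minor B (m # w) cs)"
    by (intro sum.cong refl)
       (use Cons.prems in \<open>auto simp: minor_expand_row sum_distrib_left mult.assoc simp del: sum.lessThan_Suc\<close>)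
  also have "\<dots> = (\<Sum>w | set w \<subseteq> {..<n} \<and> length w = length (r # rs).
      prod_list (map2 A (r # rs) w) * minor B w cs)"
    unfolding W sum.reindex[OF inj] sum.cartesian_product by (simp add: case_prod_unfold)
  finally show ?case .
qed

lemma minor_permute_rows:
  assumes "p permutes {..<length rs}"
  shows "minor X (permute_list p rs) cs = of_int (sign p) * minor X rs cs"
proof -
  let ?n = "length rs"
  let ?M = "mat ?n ?n (\<lambda>(a, b). X (rs ! a) (cs ! b))"
  have p: "p permutes {0..<?n}" using assms by (simp add: lessThan_atLeast0)
  have "p i < ?n" if "i < ?n" for i
    using permutes_in_image[OF assms, of i] that by simp
  then have "mat ?n ?n (\<lambda>(a, b). X (permute_list p rs ! a) (cs ! b)) =
      mat ?n ?n (\<lambda>(i, j). ?M $$ (p i, j))"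
    by (intro eq_matI) (auto simp: permute_list_nth[OF assms])
  then have "minor X (permute_list p rs) cs = det (mat ?n ?n (\<lambda>(i, j). ?M $$ (p i, j)))"
    by (simp add: minor_def)
  then show ?thesis
    using det_permute_rows[of ?M ?n p] p by (simp add: minor_def)
qed

text \<open>Second half of Cauchy--Binet: reordering the rows of \<open>B\<close> only produces a
  sign, and these signs turn the products of entries of \<open>A\<close> into the Leibniz
  formula.\<close>

lemma sum_rearrangements:
  fixes A B :: "nat \<Rightarrow> nat \<Rightarrow> 'a :: comm_ring_1"
  assumes M: "distinct M" "length M = length rs"
  shows "(\<Sum>w | mset w = mset M. prod_list (map2 A rs w) * minor B w cs) = minor A rs M * minor B M cs"
proof -
  let ?n = "length rs"
  let ?P = "{p. p permutes {..<?n}}"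
  have im: "{w. mset w = mset M} = (\<lambda>p. permute_list p M) ` ?P"
  proof (intro equalityI subsetI)
    fix w assume "w \<in> {w. mset w = mset M}"
    then have "mset w = mset M" by simp
    then obtain p where "p permutes {..<length M}" "permute_list p M = w"
      by (rule mset_eq_permutation)
    then show "w \<in> (\<lambda>p. permute_list p M) ` ?P"
      using M(2) by force
  qed (use M(2) in auto)
  have inj: "inj_on (\<lambda>p. permute_list p M) ?P"
  proof (rule inj_onI)
    fix p q assume pq: "p \<in> ?P" "q \<in> ?P" and eq: "permute_list p M = permute_list q M"
    show "p = q"
    proof
      fix i
      show "p i = q i"
      proof (cases "i < ?n")
        case True
        with pq have "p i < ?n" "q i < ?n"
          using permutes_in_image[of p "{..<?n}" i] permutes_in_image[of q "{..<?n}" i] by auto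
        moreover have "M ! p i = M ! q i"
          using arg_cong[OF eq, of "\<lambda>w. w ! i"] True M(2) pq by (auto simp: permute_list_nth)
        ultimately show ?thesis using M by (simp add: nth_eq_iff_index_eq)
      next
        case False
        with pq show ?thesis by (simp add: permutes_not_in)
      qed
    qed
  qed
  have pr: "prod_list (map2 A rs (permute_list p M)) = (\<Prod>i<?n. A (rs ! i) (M ! p i))" if "p \<in> ?P" for p
  proof -
    have "prod_list (map2 A rs (permute_list p M)) =
        prod_list (map (\<lambda>i. A (rs ! i) (M ! p i)) [0..<?n])"
      using that M(2) by (intro arg_cong[of _ _ prod_list] nth_equalityI) (auto simp: permute_list_nth)
    then show ?thesis
      by (simp add: prod.distinct_set_conv_list[symmetric] lessThan_atLeast0)
  qed
  have "(\<Sum>w | mset w = mset M. prod_list (map2 A rs w) * minor B w cs) =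
      (\<Sum>p\<in>?P. (\<Prod>i<?n. A (rs ! i) (M ! p i)) * (of_int (sign p) * minor B M cs))"
    unfolding im sum.reindex[OF inj] comp_def
    by (intro sum.cong refl) (use M(2) pr in \<open>simp add: minor_permute_rows\<close>)
  also have "\<dots> = (\<Sum>p\<in>?P. of_int (sign p) * (\<Prod>i<?n. A (rs ! i) (M ! p i))) * minor B M cs"
    by (simp add: sum_distrib_left mult_ac)
  also have "(\<Sum>p\<in>?P. of_int (sign p) * (\<Prod>i<?n. A (rs ! i) (M ! p i))) = minor A rs M"
    unfolding minor_def det_def'[OF mat_carrier] lessThan_atLeast0[symmetric]
  proof (intro sum.cong refl arg_cong2[of _ _ _ _ "(*)"] prod.cong)
    fix p i assume "p \<in> ?P" "i \<in> {..<?n}"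
    then show "A (rs ! i) (M ! p i) = mat ?n ?n (\<lambda>(a, b). A (rs ! a) (M ! b)) $$ (i, p i)"
      using permutes_in_image[of p "{..<?n}" i] by simp
  qed
  finally show ?thesis .
qed

text \<open>Lists with a repeated entry contribute 0; the others are grouped by the list that
  sorting makes of them.\<close>

theorem Cauchy_Binet:
  fixes A B :: "nat \<Rightarrow> nat \<Rightarrow> 'a :: comm_ring_1"
  assumes "length cs = length rs"
  shows "minor (\<lambda>r c. \<Sum>m<n. A r m * B m c) rs cs =
    (\<Sum>M\<in>incr_lists n (length rs). minor A rs M * minor B M cs)"
proof -
  let ?j = "length rs"
  let ?W = "{w. set w \<subseteq> {..<n} \<and> length w = ?j}"
  let ?D = "{w \<in> ?W. distinct w}"
  let ?g = "\<lambda>w. prod_list (map2 A rs w) * minor B w cs"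
  have fin: "finite ?W"
    using finite_lists_length_eq[of "{..<n}" ?j] by simp
  then have fin': "finite ?D"
    by (rule rev_finite_subset) auto
  have "minor (\<lambda>r c. \<Sum>m<n. A r m * B m c) rs cs = sum ?g ?W"
    by (rule minor_mult_lists[OF assms])
  also have "\<dots> = sum ?g ?D"
    by (rule sum.mono_neutral_right) (use fin in \<open>auto simp: minor_eq_rows\<close>)
  also have "\<dots> = (\<Sum>M\<in>incr_lists n ?j. sum ?g {w \<in> ?D. sort w = M})"
    by (rule sum.group[OF fin' finite_incr_lists, symmetric])
       (auto simp: incr_lists_def strict_sorted_iff)
  also have "\<dots> = (\<Sum>M\<in>incr_lists n ?j. minor A rs M * minor B M cs)"
  proof (rule sum.cong[OF refl])
    fix M assume "M \<in> incr_lists n ?j"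
    then have M: "distinct M" "sorted M" "set M \<subseteq> {..<n}" "length M = ?j"
      by (auto simp: incr_lists_def strict_sorted_iff)
    have "{w \<in> ?D. sort w = M} = {w. mset w = mset M}"
      using M by (auto simp: properties_for_sort dest: mset_eq_setD mset_eq_length
          mset_eq_imp_distinct_iff[THEN iffD2])
    then show "sum ?g {w \<in> ?D. sort w = M} = minor A rs M * minor B M cs"
      using sum_rearrangements[OF M(1,4)] by simp
  qed
  finally show ?thesis .
qed

text \<open>The factor \<open>\<phi> c\<close> is, up to sign, the minor on the rows \<open>rs'\<close> with \<open>c\<close> inserted into
  \<open>xs @ ys\<close>; it vanishes on \<open>xs @ ys\<close> and is a combination of the rows \<open>rs'\<close>, so bordering the
  rows \<open>rs\<close> by \<open>\<phi>\<close> gives a vanishing determinant with only three nonzero entries in the new row.\<close>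

lemma minor_three_term:
  fixes X :: "nat \<Rightarrow> nat \<Rightarrow> 'a :: comm_ring_1"
  assumes "set rs' \<subseteq> set rs" "length rs' = Suc (length xs + length ys)" "length rs = Suc (length rs')"
  shows "minor X rs' (xs @ p # ys) * minor X rs (a # xs @ ys @ [e]) =
     minor X rs' (a # xs @ ys) * minor X rs (xs @ p # ys @ [e]) +
     minor X rs' (xs @ ys @ [e]) * minor X rs (a # xs @ p # ys)"
proof -
  define u v where "u = length xs" and "v = length ys"
  define co where "co i = (-1) ^ i * minor X (take i rs' @ drop (Suc i) rs') (xs @ ys)" for i
  define \<phi> where "\<phi> c = (\<Sum>i<length rs'. co i * X (rs' ! i) c)" for c
  define s where "s = a # xs @ p # ys @ [e]"
  define del where "del b = take b s @ drop (Suc b) s" for b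
  have len: "length s = Suc (length rs)" using assms by (simp add: s_def)
  have phi: "minor X rs' (zs @ c # ws) = (-1) ^ length zs * \<phi> c" if "zs @ ws = xs @ ys" for zs ws c
  proof -
    have "length zs + length ws = length xs + length ys"
      using arg_cong[OF that, of length] by simp
    then show ?thesis
      using assms(2) that
      by (simp add: minor_expand_col[of rs' zs ws] \<phi>_def co_def sum_distrib_left power_add mult_ac
          del: sum.lessThan_Suc)
  qed
  have zero: "\<phi> c = 0" if "c \<in> set (xs @ ys)" for c
  proof -
    have "minor X rs' ([] @ c # xs @ ys) = 0"
      by (rule minor_eq_cols) (use that assms in auto)
    then show ?thesis using phi[of "[]" "xs @ ys" c] by simp
  qed
  have row: "(\<Sum>b<length s. (-1) ^ b * X r (s ! b) * minor X rs (del b)) = 0" if "r \<in> set rs" for r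
  proof -
    have "minor X (r # rs) s = 0"
      by (rule minor_eq_rows) (use that in auto)
    then show ?thesis
      unfolding del_def using minor_expand_row[of s rs X r] len by simp
  qed
  have "(\<Sum>b<length s. (-1) ^ b * \<phi> (s ! b) * minor X rs (del b)) =
      (\<Sum>i<length rs'. co i * (\<Sum>b<length s. (-1) ^ b * X (rs' ! i) (s ! b) * minor X rs (del b)))"
    unfolding \<phi>_def by (simp add: sum_distrib_left sum_distrib_right mult_ac, subst sum.swap, simp)
  also have "\<dots> = 0"
    using row assms(1) by (intro sum.neutral ballI) (simp add: subset_iff)
  finally have total: "(\<Sum>b<length s. (-1) ^ b * \<phi> (s ! b) * minor X rs (del b)) = 0" .
  \<comment> \<open>The positions of \<open>a\<close>, \<open>p\<close> and \<open>e\<close> in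
    \<open>s\<close>; every other entry lies in \<open>xs @ ys\<close>, where \<open>\<phi>\<close>
    vanishes.\<close>
  have "(\<Sum>b<length s. (-1) ^ b * \<phi> (s ! b) * minor X rs (del b)) =
      (\<Sum>b\<in>{0, Suc u, Suc (Suc (u + v))}. (-1) ^ b * \<phi> (s ! b) * minor X rs (del b))"
  proof (rule sum.mono_neutral_right)
    show "\<forall>b\<in>{..<length s} - {0, Suc u, Suc (Suc (u + v))}. (-1) ^ b * \<phi> (s ! b) * minor X rs (del b) = 0"
    proof
      fix b assume "b \<in> {..<length s} - {0, Suc u, Suc (Suc (u + v))}"
      then obtain b' where b: "b = Suc b'" "b' < Suc (u + v)" "b' \<noteq> u"
        by (cases b) (auto simp: s_def u_def v_def)
      then have "s ! b \<in> set (xs @ ys)"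
        by (cases "b' < u") (auto simp: s_def u_def v_def nth_append nth_Cons split: nat.split)
      then show "(-1) ^ b * \<phi> (s ! b) * minor X rs (del b) = 0" using zero by simp
    qed
  qed (auto simp: s_def u_def v_def)
  also have "\<dots> = \<phi> a * minor X rs (xs @ p # ys @ [e])
      - (-1) ^ u * \<phi> p * minor X rs (a # xs @ ys @ [e])
      + (-1) ^ (u + v) * \<phi> e * minor X rs (a # xs @ p # ys)"
    by (simp add: del_def s_def u_def v_def nth_append)
  finally have "(-1) ^ u * \<phi> p * minor X rs (a # xs @ ys @ [e]) =
      \<phi> a * minor X rs (xs @ p # ys @ [e]) + (-1) ^ (u + v) * \<phi> e * minor X rs (a # xs @ p # ys)"
    using total by (simp add: algebra_simps)
  moreover have "minor X rs' (xs @ p # ys) = (-1) ^ u * \<phi> p"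
    using phi[of xs ys p] by (simp add: u_def)
  moreover have "minor X rs' (a # xs @ ys) = \<phi> a"
    using phi[of "[]" "xs @ ys" a] by simp
  moreover have "minor X rs' (xs @ ys @ [e]) = (-1) ^ (u + v) * \<phi> e"
    using phi[of "xs @ ys" "[]" e] by (simp add: u_def v_def)
  ultimately show ?thesis by simp
qed

section \<open>From consecutive to arbitrary columns\<close>

lemma incr_listsD:
  assumes "xs \<in> incr_lists n j"
  shows "sorted_wrt (<) xs" "set xs \<subseteq> {..<n}" "length xs = j" "distinct xs"
  using assms by (auto simp: incr_lists_def strict_sorted_iff)

text \<open>In the main use, \<open>d\<close> is the degree of \<open>q\<close> and
  \<open>m = n - d\<close>; column lists violating the bound are then dependent.\<close>

definition few_above :: "nat \<Rightarrow> nat \<Rightarrow> nat list \<Rightarrow> bool" where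
  "few_above m d xs \<longleftrightarrow> length (filter ((\<le>) m) xs) \<le> d"

lemma sorted_wrt_less_interval:
  assumes "sorted_wrt (<) xs" "set xs \<subseteq> {a..<a + length xs}"
  shows "xs = [a..<a + length xs]"
proof (rule strict_sorted_equal)
  have "card (set xs) = length xs"
    using assms(1) by (simp add: distinct_card strict_sorted_iff)
  then show "set xs = set [a..<a + length xs]"
    using assms(2) card_subset_eq[of "{a..<a + length xs}" "set xs"] by simp
qed (use assms in auto)

text \<open>Fekete's argument, by induction on the spread \<open>last cs - hd cs\<close>: the
  three-term identity relates a list with a gap to lists of smaller spread, and the factor to be
  divided out is positive by the hypothesis on order \<open>j\<close>. \<open>strict\<close> is a
  flag because at the top order the windows are only known to be nonnegative.\<close>

lemma minor_nonneg_of_consecutive: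
  fixes Y :: "nat \<Rightarrow> nat \<Rightarrow> real"
  assumes lower: "\<And>rs cs. \<lbrakk>rs \<in> incr_lists n j; sorted_wrt (<) cs; length cs = j\<rbrakk> \<Longrightarrow>
      0 \<le> minor Y rs cs \<and> (few_above m d cs \<longrightarrow> 0 < minor Y rs cs)"
    and window: "\<And>a. 0 \<le> minor Y rs [a..<a + Suc j] \<and>
      (strict \<longrightarrow> few_above m d [a..<a + Suc j] \<longrightarrow> 0 < minor Y rs [a..<a + Suc j])"
    and many: "\<And>cs. \<lbrakk>sorted_wrt (<) cs; length cs = Suc j; \<not> few_above m d cs\<rbrakk> \<Longrightarrow> minor Y rs cs = 0"
    and rs: "rs \<in> incr_lists n (Suc j)"
    and cs: "sorted_wrt (<) cs" "length cs = Suc j"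
  shows "0 \<le> minor Y rs cs \<and> (strict \<longrightarrow> few_above m d cs \<longrightarrow> 0 < minor Y rs cs)"
  using cs
proof (induction "last cs - hd cs" arbitrary: cs rule: less_induct)
  case less
  consider "cs = [hd cs..<hd cs + Suc j]" | "\<not> few_above m d cs" |
    "few_above m d cs" "cs \<noteq> [hd cs..<hd cs + Suc j]" by blast
  then show ?case
  proof cases
    case 1
    then show ?thesis using window[of "hd cs"] by simp
  next
    case 2
    then show ?thesis using many less.prems by simp
  next
    case 3
    from less.prems obtain a ws where cs: "cs = a # ws" by (cases cs) auto
    have "ws \<noteq> []" using 3 cs less.prems by auto
    then obtain zs e where ws: "ws = zs @ [e]" by (cases ws rule: rev_cases) auto
    note cs = cs[unfolded ws]
    have srt: "sorted_wrt (<) (a # zs @ [e])" and len: "Suc (length zs) = j"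
      using less.prems cs by auto
    \<comment> \<open>Otherwise the \<open>j + 1\<close> entries fill an interval and form a
      window.\<close>
    have ae: "a + j < e"
    proof (rule ccontr)
      assume "\<not> a + j < e"
      then have "set cs \<subseteq> {a..<a + length cs}"
        using srt less.prems(2) by (fastforce simp: cs sorted_wrt_append)
      then show False
        using sorted_wrt_less_interval[OF less.prems(1), of a] 3(2) by (metis cs less.prems(2) list.sel(1))
    qed
    \<comment> \<open>Pigeonhole: \<open>zs\<close> has \<open>j - 1\<close> entries, but at least
      \<open>j\<close> integers lie strictly between \<open>a\<close> and \<open>e\<close>.\<close>
    have "card (set zs) < card {a<..<e}"
      using card_length[of zs] len ae by simp
    then have "\<not> {a<..<e} \<subseteq> set zs"
      using card_mono[of "set zs" "{a<..<e}"] by auto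
    then obtain p where p: "a < p" "p < e" "p \<notin> set zs"
      by (metis greaterThanLessThan_iff subsetI)
    define xs ys where "xs = takeWhile (\<lambda>z. z < p) zs" and "ys = dropWhile (\<lambda>z. z < p) zs"
    have zs: "zs = xs @ ys" by (simp add: xs_def ys_def)
    have xs: "\<forall>x\<in>set xs. x < p" by (auto simp: xs_def dest: set_takeWhileD)
    have ys: "\<forall>y\<in>set ys. p < y"
    proof (cases ys)
      case (Cons y ys')
      then have "\<not> y < p" using hd_dropWhile[of "\<lambda>z. z < p" zs] by (simp add: ys_def)
      moreover have "y \<noteq> p" using p(3) zs Cons by auto
      ultimately show ?thesis using Cons srt zs by (fastforce simp: sorted_wrt_append)
    qed simp
    \<comment> \<open>Any \<open>j\<close> of the rows would serve for the minors of order
      \<open>j\<close>.\<close>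
    define rs' where "rs' = take j rs"
    have rs': "rs' \<in> incr_lists n j" "set rs' \<subseteq> set rs"
      using rs set_take_subset[of j rs] by (auto simp: incr_lists_def rs'_def sorted_wrt_take)
    have three: "minor Y rs' (xs @ p # ys) * minor Y rs cs =
        minor Y rs' (a # xs @ ys) * minor Y rs (xs @ p # ys @ [e]) +
        minor Y rs' (xs @ ys @ [e]) * minor Y rs (a # xs @ p # ys)"
      using minor_three_term[OF rs'(2), of xs ys Y p a e] incr_listsD(3)[OF rs] incr_listsD(3)[OF rs'(1)]
        len zs cs by simp
    have sorted: "sorted_wrt (<) (xs @ p # ys)" "sorted_wrt (<) (a # xs @ ys)"
      "sorted_wrt (<) (xs @ p # ys @ [e])" "sorted_wrt (<) (xs @ ys @ [e])"
      "sorted_wrt (<) (a # xs @ p # ys)"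
      using srt p xs ys unfolding zs by (auto simp: sorted_wrt_append)
    \<comment> \<open>Replacing \<open>e\<close> by the smaller \<open>p\<close> cannot raise the
      number of entries from \<open>m\<close> on. Replacing \<open>a\<close> by \<open>p\<close>
      can, so for \<open>xs @ p # ys @ [e]\<close> only nonnegativity is available, and strictness
      comes from the other summand.\<close>
    have few: "few_above m d (xs @ p # ys)" "few_above m d (xs @ ys @ [e])"
      "few_above m d (a # xs @ p # ys)"
      using 3(1) p unfolding cs zs few_above_def by (auto split: if_splits)
    have "0 < minor Y rs' (xs @ p # ys)" "0 \<le> minor Y rs' (a # xs @ ys)"
      "0 < minor Y rs' (xs @ ys @ [e])"
      using lower[OF rs'(1)] sorted few len zs by auto
    moreover have "0 \<le> minor Y rs (xs @ p # ys @ [e])"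
    proof -
      have "e - hd (xs @ p # ys @ [e]) < e - a"
        using srt p zs by (cases xs) (auto intro!: diff_less_mono2)
      then show ?thesis
        using less.hyps[of "xs @ p # ys @ [e]"] sorted len zs cs by simp
    qed
    moreover have "0 \<le> minor Y rs (a # xs @ p # ys) \<and> (strict \<longrightarrow> 0 < minor Y rs (a # xs @ p # ys))"
    proof -
      have "last (xs @ p # ys) < e"
        using sorted(3) by (auto simp: sorted_wrt_append)
      moreover have "a < last (xs @ p # ys)"
        using sorted(5) by (auto simp: sorted_wrt_append)
      ultimately have "last (a # xs @ p # ys) - a < e - a" by auto
      then show ?thesis
        using less.hyps[of "a # xs @ p # ys"] sorted len zs cs few by simp
    qed
    ultimately show ?thesis
      using 3(1) three
      by (smt (verit, ccfv_threshold) mult_nonneg_nonneg mult_pos_pos mult_less_0_iff zero_less_mult_pos)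
  qed
qed

section \<open>Strict total positivity of Vandermonde and Gaussian matrices\<close>

text \<open>As a polynomial in the node of the first row, the determinant vanishes at the other
  nodes, and its leading coefficient is, up to sign, the determinant for the remaining rows. This
  splits off the factors that contain the first node.\<close>

lemma Vandermonde_pos:
  fixes x :: "nat \<Rightarrow> real"
  assumes "strict_mono x" "sorted_wrt (<) rs"
  shows "0 < minor (\<lambda>r c. x r ^ c) rs [0..<length rs]"
  using assms(2)
proof (induction rs)
  case (Cons r rs)
  let ?X = "\<lambda>r c. x r ^ c"
  let ?n = "length rs"
  let ?V = "minor ?X rs [0..<?n]"
  define co where "co b = (-1) ^ b * minor ?X rs (take b [0..<Suc ?n] @ drop (Suc b) [0..<Suc ?n])" for b
  define P where "P = (\<Sum>b<Suc ?n. monom (co b) b)"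
  define Q where "Q = smult (co ?n) (\<Prod>r'\<leftarrow>rs. [:- x r', 1:])"
  have co: "co ?n = (-1) ^ ?n * ?V" by (simp add: co_def)
  have poly_P: "poly P (x r) = minor ?X (r # rs) [0..<Suc ?n]" for r
    by (subst minor_expand_row)
      (simp_all add: P_def co_def poly_sum poly_monom mult_ac del: sum.lessThan_Suc upt_Suc)
  have poly_Q: "poly Q y = co ?n * (\<Prod>r'\<leftarrow>rs. y - x r')" for y
  proof -
    have "poly (\<Prod>r'\<leftarrow>rs. [:- x r', 1:]) y = (\<Prod>r'\<leftarrow>rs. y - x r')" for rs
      by (induction rs) (auto simp: algebra_simps)
    then show ?thesis by (simp add: Q_def)
  qed
  have monic: "monic (\<Prod>r'\<leftarrow>rs. [:- x r', 1:])" and deg: "degree (\<Prod>r'\<leftarrow>rs. [:- x r', 1:]) = ?n"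
  proof -
    show "degree (\<Prod>r'\<leftarrow>rs. [:- x r', 1:]) = ?n"
      by (rule degree_linear_factors)
    show "monic (\<Prod>r'\<leftarrow>rs. [:- x r', 1:])"
      by (rule monic_prod_list) auto
  qed
  have "inj_on x (set rs)"
    using assms(1) by (simp add: strict_mono_imp_increasing strict_mono_eq inj_on_def)
  then have card: "card (x ` set rs) = ?n"
    using Cons.prems by (simp add: card_image distinct_card strict_sorted_iff)
  have "P = Q"
  proof (rule poly_eqI_degree_lead_coeff[where A = "x ` set rs" and n = "?n"])
    show "coeff P ?n = coeff Q ?n"
      using monic deg by (simp add: P_def Q_def coeff_sum)
    show "degree P \<le> ?n"
      unfolding P_def by (rule degree_sum_le) (auto intro: order.trans[OF degree_monom_le])
    show "degree Q \<le> ?n"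
      unfolding Q_def using deg degree_smult_le by metis
    fix z assume "z \<in> x ` set rs"
    then obtain r' where r': "r' \<in> set rs" "z = x r'" by auto
    have "poly P z = 0"
      unfolding r'(2) poly_P by (rule minor_eq_rows) (use r'(1) in auto)
    moreover have "poly Q z = 0"
      using r' by (auto simp: poly_Q prod_list_zero_iff)
    ultimately show "poly P z = poly Q z" by simp
  qed (use card in simp)
  then have "minor ?X (r # rs) [0..<Suc ?n] = (-1) ^ ?n * ?V * (\<Prod>r'\<leftarrow>rs. x r - x r')"
    using poly_P[of r] poly_Q[of "x r"] co by simp
  \<comment> \<open>All \<open>?n\<close> differences change sign, which cancels the sign of
    \<open>co ?n\<close>.\<close>
  also have "\<dots> = ?V * (\<Prod>r'\<leftarrow>rs. x r' - x r)"
  proof -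
    have "(-1) ^ length rs * (\<Prod>r'\<leftarrow>rs. x r - x r') = (\<Prod>r'\<leftarrow>rs. x r' - x r)" for rs
      by (induction rs) (auto simp: algebra_simps)
    then show ?thesis by (simp add: mult_ac)
  qed
  also have "\<dots> > 0"
  proof -
    have "\<forall>r'\<in>set rs. x r < x r'"
      using Cons.prems assms(1) by (simp add: strict_mono_less)
    then have "0 < (\<Prod>r'\<leftarrow>rs. x r' - x r)"
      by (induction rs) auto
    then show ?thesis using Cons by simp
  qed
  finally show ?case by simp
qed simp

text \<open>For consecutive exponents, taking the factor \<open>x r ^ a\<close> out of each row
  leaves an ordinary Vandermonde determinant; Fekete's argument handles the gaps.\<close>

lemma generalized_Vandermonde_pos:
  fixes x :: "nat \<Rightarrow> real"
  assumes "strict_mono x" "\<And>r. 0 < x r"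
    and "rs \<in> incr_lists n j" "sorted_wrt (<) cs" "length cs = j"
  shows "0 < minor (\<lambda>r c. x r ^ c) rs cs"
  using assms(3-)
proof (induction j arbitrary: rs cs)
  case 0
  then show ?case by (simp add: incr_lists_def)
next
  case (Suc j)
  let ?X = "\<lambda>r c. x r ^ c"
  have window: "0 < minor ?X rs [a..<a + Suc j]" for a
  proof -
    have "minor ?X rs [a..<a + Suc j] = minor (\<lambda>r c. x r ^ a * 1 * x r ^ c) rs [0..<length rs]"
      using incr_listsD[OF Suc.prems(1)] by (intro minor_cong) (auto simp: power_add simp del: upt_Suc)
    also have "\<dots> = (\<Prod>r\<leftarrow>rs. x r ^ a) * minor ?X rs [0..<length rs]"
      by (subst minor_scale) (auto simp: map_replicate_const prod_list_replicate)
    also have "\<dots> > 0"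
    proof -
      have "0 < (\<Prod>r\<leftarrow>rs. x r ^ a)" using assms(2) by (induction rs) auto
      then show ?thesis
        using Vandermonde_pos[OF assms(1) incr_listsD(1)[OF Suc.prems(1)]] by simp
    qed
    finally show ?thesis .
  qed
  \<comment> \<open>With \<open>m = 0\<close> and \<open>d = Suc j\<close> the bound holds for every
    list that occurs, so that positivity is obtained throughout.\<close>
  have few: "few_above 0 (Suc j) cs" if "length cs \<le> Suc j" for cs
    using that by (simp add: few_above_def le_trans[OF length_filter_le])
  have "0 \<le> minor ?X rs cs \<and> (True \<longrightarrow> few_above 0 (Suc j) cs \<longrightarrow> 0 < minor ?X rs cs)"
    by (rule minor_nonneg_of_consecutive[where n = n and j = j])
       (use Suc window few in \<open>auto intro: less_imp_le simp del: upt_Suc\<close>)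
  then show ?case using few Suc.prems by simp
qed

text \<open>With truncated subtraction one of the two squares is 0, so the exponent is \<open>\<bar>a - b\<bar>\<^sup>2\<close>.  As
  \<open>0 ^ 0 = 1\<close>, the kernel is a polynomial in \<open>s\<close> that is the identity at \<open>s = 0\<close>.\<close>

definition gauss_kernel :: "real \<Rightarrow> nat \<Rightarrow> nat \<Rightarrow> real" where
  "gauss_kernel s a b = s ^ ((a - b)\<^sup>2 + (b - a)\<^sup>2)"

lemma gauss_kernel_0: "gauss_kernel 0 a b = (if a = b then 1 else 0)"
  by (auto simp: gauss_kernel_def)

text \<open>Since \<open>(a - b)^2 = a^2 + b^2 - 2ab\<close>, the kernel is, up to diagonal factors,
  a generalized Vandermonde matrix with nodes \<open>s^(-2r)\<close>, which increase because
  \<open>s < 1\<close>.\<close>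

lemma gauss_kernel_totally_positive:
  assumes "0 < s" "s < 1" "rs \<in> incr_lists n j" "cs \<in> incr_lists m j"
  shows "0 < minor (gauss_kernel s) rs cs"
proof -
  define x where "x r = (1 / s) ^ (2 * r)" for r :: nat
  have eq: "gauss_kernel s a b = s ^ a\<^sup>2 * s ^ b\<^sup>2 * x a ^ b" for a b
  proof -
    have "(a - b)\<^sup>2 + (b - a)\<^sup>2 + 2 * a * b = a\<^sup>2 + b\<^sup>2"
    proof (cases "a \<le> b")
      case True
      then obtain e where "b = a + e" by (auto simp: le_iff_add)
      then show ?thesis by (simp add: power2_eq_square algebra_simps)
    next
      case False
      then obtain e where "a = b + e" by (metis le_iff_add nat_le_linear)
      then show ?thesis by (simp add: power2_eq_square algebra_simps)
    qed
    then have "s ^ ((a - b)\<^sup>2 + (b - a)\<^sup>2) * s ^ (2 * a * b) = s ^ a\<^sup>2 * s ^ b\<^sup>2"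
      by (metis power_add)
    then show ?thesis
      using assms(1) by (simp add: gauss_kernel_def x_def power_divide field_simps flip: power_mult)
  qed
  have "strict_mono x"
    using assms by (auto simp: x_def strict_mono_def intro!: power_strict_increasing)
  moreover have "0 < x r" for r
    using assms(1) by (simp add: x_def)
  ultimately have "0 < minor (\<lambda>r c. x r ^ c) rs cs"
    using assms by (intro generalized_Vandermonde_pos[where n = n and j = j])
      (auto simp: incr_lists_def)
  moreover have "0 < (\<Prod>r\<leftarrow>rs. s ^ r\<^sup>2)" for rs
    using assms(1) by (induction rs) auto
  moreover have "minor (gauss_kernel s) rs cs =
      (\<Prod>r\<leftarrow>rs. s ^ r\<^sup>2) * (\<Prod>c\<leftarrow>cs. s ^ c\<^sup>2) * minor (\<lambda>r c. x r ^ c) rs cs"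
    unfolding eq[abs_def] using assms by (intro minor_scale) (simp add: incr_lists_def)
  ultimately show ?thesis by simp
qed

section \<open>Gaussian smoothing and passage to the limit\<close>

text \<open>The smoothed minor is a polynomial in \<open>s\<close>, hence continuous, and at
  \<open>s = 0\<close> it is the original one.\<close>

lemma minor_limit_nonneg:
  fixes X :: "nat \<Rightarrow> nat \<Rightarrow> real"
  assumes "set rs \<subseteq> {..<n}" "length cs = length rs"
    and "\<And>s. \<lbrakk>0 < s; s < 1\<rbrakk> \<Longrightarrow> 0 \<le> minor (\<lambda>r c. \<Sum>m<n. gauss_kernel s r m * X m c) rs cs"
  shows "0 \<le> minor X rs cs"
proof -
  let ?f = "\<lambda>s. minor (\<lambda>r c. \<Sum>m<n. gauss_kernel s r m * X m c) rs cs"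
  have "isCont ?f 0"
    unfolding minor_def det_def'[OF mat_carrier] gauss_kernel_def
    by (intro continuous_intros) (auto intro!: continuous_intros)
  then have "(?f \<longlongrightarrow> ?f 0) (at_right 0)"
    by (simp add: isCont_def filterlim_at_split)
  moreover have "eventually (\<lambda>s. 0 \<le> ?f s) (at_right 0)"
    unfolding eventually_at_right_field using assms(3) by (intro exI[of _ 1]) auto
  ultimately have "0 \<le> ?f 0"
    by (rule tendsto_lowerbound) simp
  also have "?f 0 = minor X rs cs"
  proof (rule minor_cong)
    fix a b assume "a < length rs" "b < length rs"
    then have "rs ! a < n" using assms(1) nth_mem by blast
    then show "(\<Sum>m<n. gauss_kernel 0 (rs ! a) m * X m (cs ! b)) = X (rs ! a) (cs ! b)"
      by (simp add: gauss_kernel_0 if_distribR if_distrib sum.delta' cong: if_cong)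
  qed (use assms(2) in auto)
  finally show ?thesis .
qed

text \<open>Fekete's argument is applied to the smoothed matrices, where independent columns give
  positive minors; the limit returns to \<open>X\<close>.\<close>

theorem minors_nonneg_of_windows:
  fixes X :: "nat \<Rightarrow> nat \<Rightarrow> real"
  assumes "k \<le> n"
    and window: "\<And>j a rs. \<lbrakk>j \<le> k; rs \<in> incr_lists n j\<rbrakk> \<Longrightarrow> 0 \<le> minor X rs [a..<a + j]"
    and few: "\<And>j a. \<lbrakk>j < k; few_above m d [a..<a + j]\<rbrakk> \<Longrightarrow>
      \<exists>rs\<in>incr_lists n j. minor X rs [a..<a + j] \<noteq> 0"
    and many: "\<And>rs cs. \<lbrakk>sorted_wrt (<) cs; \<not> few_above m d cs; rs \<in> incr_lists n (length cs)\<rbrakk> \<Longrightarrow>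
      minor X rs cs = 0"
    and "j \<le> k" "rs \<in> incr_lists n j" "sorted_wrt (<) cs" "length cs = j"
  shows "0 \<le> minor X rs cs"
proof -
  \<comment> \<open>The induction carries independence along with nonnegativity: by Cauchy--Binet,
    one nonzero minor of \<open>X\<close> makes all smoothed minors on these columns positive, as
    the division at the next order requires.\<close>
  have "(\<forall>rs cs. rs \<in> incr_lists n j \<and> sorted_wrt (<) cs \<and> length cs = j \<longrightarrow> 0 \<le> minor X rs cs) \<and>
    (j < k \<longrightarrow> (\<forall>cs. sorted_wrt (<) cs \<and> length cs = j \<and> few_above m d cs \<longrightarrow>
      (\<exists>rs\<in>incr_lists n j. minor X rs cs \<noteq> 0)))"
    using \<open>j \<le> k\<close>
  proof (induction j)
    case 0
    then show ?case by (auto simp: incr_lists_def)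
  next
    case (Suc j)
    define Y where "Y s r c = (\<Sum>m<n. gauss_kernel s r m * X m c)" for s r c
    have CB: "minor (Y s) rs cs = (\<Sum>M\<in>incr_lists n i. minor (gauss_kernel s) rs M * minor X M cs)"
      if "rs \<in> incr_lists n i" "length cs = i" for s rs cs i
      unfolding Y_def[abs_def] using Cauchy_Binet[of cs rs] that by (simp add: incr_lists_def)
    have nonneg: "0 \<le> minor (Y s) rs cs"
      if s: "0 < s" "s < 1" and "rs \<in> incr_lists n i" "length cs = i"
        and "\<And>M. M \<in> incr_lists n i \<Longrightarrow> 0 \<le> minor X M cs" for s rs cs i
      unfolding CB[OF that(3,4)]
      by (intro sum_nonneg mult_nonneg_nonneg less_imp_le[OF gauss_kernel_totally_positive[OF s that(3)]] that)
    have pos: "0 < minor (Y s) rs cs"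
      if s: "0 < s" "s < 1" and "rs \<in> incr_lists n i" "length cs = i"
        and nn: "\<And>M. M \<in> incr_lists n i \<Longrightarrow> 0 \<le> minor X M cs"
        and ex: "\<exists>M\<in>incr_lists n i. minor X M cs \<noteq> 0" for s rs cs i
    proof -
      from ex obtain M where M: "M \<in> incr_lists n i" "0 < minor X M cs"
        using nn by force
      show ?thesis
        unfolding CB[OF that(3,4)]
      proof (rule sum_pos2[OF finite_incr_lists M(1)])
        show "0 < minor (gauss_kernel s) rs M * minor X M cs"
          using gauss_kernel_totally_positive[OF s that(3) M(1)] M(2) by simp
        show "0 \<le> minor (gauss_kernel s) rs M' * minor X M' cs" if "M' \<in> incr_lists n i" for M'
          using gauss_kernel_totally_positive[OF s \<open>rs \<in> _\<close> that] nn[OF that] by simp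
      qed
    qed
    have main: "0 \<le> minor (Y s) rs cs \<and> (Suc j < k \<longrightarrow> few_above m d cs \<longrightarrow> 0 < minor (Y s) rs cs)"
      if s: "0 < s" "s < 1" and rs: "rs \<in> incr_lists n (Suc j)"
        and cs: "sorted_wrt (<) cs" "length cs = Suc j" for s rs cs
    proof (rule minor_nonneg_of_consecutive[where n = n and j = j, OF _ _ _ rs cs])
      fix rs' and cs' :: "nat list" assume rs': "rs' \<in> incr_lists n j" and cs': "sorted_wrt (<) cs'" "length cs' = j"
      show "0 \<le> minor (Y s) rs' cs' \<and> (few_above m d cs' \<longrightarrow> 0 < minor (Y s) rs' cs')"
        using nonneg[OF s rs' cs'(2)] pos[OF s rs' cs'(2)] Suc cs' by simp
    next
      fix a
      have len: "length [a..<a + Suc j] = Suc j" by simp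
      show "0 \<le> minor (Y s) rs [a..<a + Suc j] \<and> (Suc j < k \<longrightarrow> few_above m d [a..<a + Suc j] \<longrightarrow>
          0 < minor (Y s) rs [a..<a + Suc j])"
        using nonneg[OF s rs len] pos[OF s rs len] window[OF Suc.prems] few[of "Suc j" a] by blast
    next
      fix cs' :: "nat list" assume cs': "sorted_wrt (<) cs'" "length cs' = Suc j" "\<not> few_above m d cs'"
      show "minor (Y s) rs cs' = 0"
        unfolding CB[OF rs cs'(2)] using many[OF cs'(1,3)] cs'(2) by (intro sum.neutral) simp
    qed
    show ?case
    proof (intro conjI allI impI)
      fix rs cs :: "nat list" assume *: "rs \<in> incr_lists n (Suc j) \<and> sorted_wrt (<) cs \<and> length cs = Suc j"
      show "0 \<le> minor X rs cs"
        by (rule minor_limit_nonneg[of rs n])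
           (use * main in \<open>auto simp: incr_lists_def Y_def[abs_def]\<close>)
    next
      fix cs :: "nat list" assume less: "Suc j < k" and *: "sorted_wrt (<) cs \<and> length cs = Suc j \<and> few_above m d cs"
      have I: "[0..<Suc j] \<in> incr_lists n (Suc j)"
        using less \<open>k \<le> n\<close> by (auto simp: incr_lists_def simp del: upt_Suc)
      \<comment> \<open>Any \<open>s\<close> strictly between 0 and 1 would do: a positive
        Cauchy--Binet sum has a nonzero term, hence a nonzero minor of \<open>X\<close> on these
        columns.\<close>
      have "0 < minor (Y (1/2)) [0..<Suc j] cs"
        using main[OF _ _ I] less * by simp
      then show "\<exists>rs\<in>incr_lists n (Suc j). minor X rs cs \<noteq> 0"
        using CB[OF I, of cs] * by (metis (no_types, lifting) less_irrefl mult_zero_right sum.neutral)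
    qed
  qed
  then show ?thesis using assms by blast
qed

section \<open>Sequences of vectors under a linear recursion\<close>

lemma sum_lessThan_shift:
  fixes f :: "nat \<Rightarrow> 'a :: comm_monoid_add"
  assumes "\<And>a. a < s \<Longrightarrow> f a = 0"
  shows "(\<Sum>a<s + N. f a) = (\<Sum>a<N. f (s + a))"
  using assms by (induction N) auto

text \<open>Fewer equations than unknowns: padded by zero rows, the square system is
  singular.\<close>

lemma wide_kernel:
  fixes C :: "nat \<Rightarrow> nat \<Rightarrow> 'a :: field"
  assumes "d < N"
  obtains x where "\<exists>a<N. x a \<noteq> 0" "\<And>e. e < d \<Longrightarrow> (\<Sum>a<N. C e a * x a) = 0"
proof -
  let ?M = "mat N N (\<lambda>(e, a). if e < d then C e a else 0)"
  have "det ?M = 0"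
    using assms by (subst laplace_expansion_row[of _ N d]) auto
  then obtain v where v: "v \<in> carrier_vec N" "v \<noteq> 0\<^sub>v N" "?M *\<^sub>v v = 0\<^sub>v N"
    using det_0_iff_vec_prod_zero_field[of ?M N] by auto
  show ?thesis
  proof
    show "\<exists>a<N. v $ a \<noteq> 0"
      using v(1,2) by (auto simp: vec_eq_iff)
    fix e assume "e < d"
    then have "(?M *\<^sub>v v) $ e = 0" using v(3) assms by simp
    then show "(\<Sum>a<N. C e a * v $ a) = 0"
      using \<open>e < d\<close> assms v(1) by (simp add: scalar_prod_def lessThan_atLeast0)
  qed
qed

text \<open>If \<open>X r l\<close> is the entry \<open>r\<close> of \<open>M^l x\<close>, this is
  the entry \<open>r\<close> of \<open>p(M) x\<close>.\<close>

definition seq_comb :: "(nat \<Rightarrow> nat \<Rightarrow> 'a :: comm_ring_1) \<Rightarrow> 'a poly \<Rightarrow> nat \<Rightarrow> 'a" where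
  "seq_comb X p r = (\<Sum>l\<le>degree p. coeff p l * X r l)"

lemma seq_comb_eq:
  assumes "\<And>l. N \<le> l \<Longrightarrow> coeff p l = 0"
  shows "seq_comb X p r = (\<Sum>l<N. coeff p l * X r l)"
proof -
  have "seq_comb X p r = (\<Sum>l<max N (Suc (degree p)). coeff p l * X r l)"
    unfolding seq_comb_def by (rule sum.mono_neutral_left) (auto simp: coeff_eq_0)
  also have "\<dots> = (\<Sum>l<N. coeff p l * X r l)"
    by (rule sum.mono_neutral_right) (auto simp: assms)
  finally show ?thesis .
qed

lemma seq_comb_add: "seq_comb X (p + q) r = seq_comb X p r + seq_comb X q r"
proof -
  define N where "N = Suc (max (degree p) (degree q))"
  have "coeff p l = 0" "coeff q l = 0" if "N \<le> l" for l
    using that by (auto simp: N_def intro: coeff_eq_0)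
  then show ?thesis
    by (simp add: seq_comb_eq[of N] distrib_right sum.distrib)
qed

lemma seq_comb_smult: "seq_comb X (smult a p) r = a * seq_comb X p r"
proof -
  have "coeff p l = 0" if "Suc (degree p) \<le> l" for l
    using that by (auto intro: coeff_eq_0)
  then show ?thesis
    by (simp add: seq_comb_eq[of "Suc (degree p)"] sum_distrib_left mult.assoc del: sum.lessThan_Suc)
qed

lemma seq_comb_diff: "seq_comb X (p - q) r = seq_comb X p r - seq_comb X q r"
  using seq_comb_add[of X p "smult (-1) q" r] seq_comb_smult[of X "-1" q r] by simp

lemma seq_comb_monom_mult:
  assumes "\<And>l. N \<le> l \<Longrightarrow> coeff p l = 0"
  shows "seq_comb X (monom 1 s * p) r = (\<Sum>l<N. coeff p l * X r (s + l))"
  by (subst seq_comb_eq[of "s + N"])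
    (auto simp: coeff_monom_mult assms sum_lessThan_shift)

text \<open>Turns a linear relation among columns into a polynomial, so that divisibility can be
  used.\<close>

definition seq_poly :: "nat \<Rightarrow> (nat \<Rightarrow> 'a :: comm_ring_1) \<Rightarrow> 'a poly" where
  "seq_poly N x = (\<Sum>a<N. monom (x a) a)"

lemma coeff_seq_poly: "coeff (seq_poly N x) l = (if l < N then x l else 0)"
  by (simp add: seq_poly_def coeff_sum)

lemma seq_comb_seq_poly: "seq_comb X (monom 1 i * seq_poly N x) r = (\<Sum>a<N. X r (i + a) * x a)"
  by (subst seq_comb_monom_mult[of N]) (auto simp: coeff_seq_poly mult.commute)

definition annihilates :: "(nat \<Rightarrow> nat \<Rightarrow> 'a :: comm_ring_1) \<Rightarrow> nat \<Rightarrow> 'a poly \<Rightarrow> bool" where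
  "annihilates X n p \<longleftrightarrow> (\<forall>r<n. seq_comb X p r = 0)"

definition indep_window :: "(nat \<Rightarrow> nat \<Rightarrow> 'a :: comm_ring_1) \<Rightarrow> nat \<Rightarrow> nat \<Rightarrow> nat \<Rightarrow> bool" where
  "indep_window X n i j \<longleftrightarrow>
    (\<forall>x. (\<forall>r<n. (\<Sum>a<j. X r (i + a) * x a) = 0) \<longrightarrow> (\<forall>a<j. x a = 0))"

text \<open>By Cauchy--Binet the Gram determinant of the window is the sum of the squares of its minors.\<close>

lemma indep_window_minor:
  fixes X :: "nat \<Rightarrow> nat \<Rightarrow> real"
  assumes "indep_window X n i j"
  shows "\<exists>rs\<in>incr_lists n j. minor X rs [i..<i + j] \<noteq> 0"
proof (rule ccontr)
  assume "\<not> ?thesis"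
  then have zero: "minor X rs [i..<i + j] = 0" if "rs \<in> incr_lists n j" for rs
    using that by blast
  let ?w = "[i..<i + j]"
  let ?G = "\<lambda>r c. \<Sum>m<n. X m r * X m c"
  have "minor ?G ?w ?w = 0"
    using Cauchy_Binet[of ?w ?w "\<lambda>r m. X m r" X n] zero by simp
  moreover have "minor ?G ?w ?w \<noteq> 0"
  proof (rule minor_nonzero_kernel)
    fix x assume x: "(\<Sum>a<length ?w. ?G r (?w ! a) * x a) = 0" if "r \<in> set ?w" for r
    \<comment> \<open>A kernel vector \<open>x\<close> of the Gram matrix \<open>G\<close> satisfies
      \<open>|y|^2 = x^T G x = 0\<close> for \<open>y = X x\<close>.\<close>
    define y where "y m = (\<Sum>a<j. X m (i + a) * x a)" for m
    have gram: "(\<Sum>m<n. X m (i + b) * y m) = 0" if "b < j" for b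
    proof -
      have "(\<Sum>m<n. X m (i + b) * y m) = (\<Sum>a<j. ?G (i + b) (i + a) * x a)"
        unfolding y_def sum_distrib_left sum_distrib_right by (subst sum.swap) (simp add: mult_ac)
      also have "\<dots> = (\<Sum>a<length ?w. ?G (i + b) (?w ! a) * x a)" by simp
      finally show ?thesis using x[of "i + b"] that by simp
    qed
    have "(y m)\<^sup>2 = (\<Sum>b<j. X m (i + b) * y m * x b)" for m
    proof -
      have "(y m)\<^sup>2 = y m * (\<Sum>b<j. X m (i + b) * x b)"
        by (simp add: power2_eq_square y_def)
      then show ?thesis by (simp add: sum_distrib_left mult_ac)
    qed
    then have "(\<Sum>m<n. (y m)\<^sup>2) = (\<Sum>m<n. \<Sum>b<j. X m (i + b) * y m * x b)"
      by simp
    also have "\<dots> = (\<Sum>b<j. (\<Sum>m<n. X m (i + b) * y m) * x b)"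
      by (subst sum.swap) (simp add: sum_distrib_right)
    also have "\<dots> = 0" using gram by simp
    finally have "\<forall>m<n. y m = 0"
      by (subst (asm) sum_nonneg_eq_0_iff) auto
    then have "\<forall>a<j. x a = 0"
      using assms unfolding indep_window_def y_def by blast
    then show "\<forall>a<length ?w. x a = 0" by simp
  qed simp
  ultimately show False by simp
qed

section \<open>Annihilating polynomials of a linear recursion\<close>

text \<open>The field is arbitrary because the recursion is used over the reals for the minors and
  over the complex numbers for the poles.\<close>

locale linear_recursion =
  fixes n :: nat and M X :: "nat \<Rightarrow> nat \<Rightarrow> 'a :: field"
  assumes step: "r < n \<Longrightarrow> X r (Suc l) = (\<Sum>m<n. M r m * X m l)"
begin

text \<open>Multiplying the polynomial by the variable applies \<open>M\<close> to the combination
  of columns, so the annihilators form an ideal.\<close>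

lemma annihilates_mult:
  assumes "annihilates X n p"
  shows "annihilates X n (q * p)"
proof (induction q)
  case 0
  then show ?case by (simp add: annihilates_def seq_comb_def)
next
  case (pCons a q)
  have "seq_comb X (pCons 0 (q * p)) r = 0" if "r < n" for r
  proof -
    have "seq_comb X (pCons 0 (q * p)) r = seq_comb X (monom 1 1 * (q * p)) r"
      by (simp add: monom_Suc monom_0)
    also have "\<dots> = (\<Sum>l<Suc (degree (q * p)). coeff (q * p) l * X r (1 + l))"
      by (rule seq_comb_monom_mult) (auto simp: coeff_eq_0)
    also have "\<dots> = (\<Sum>l<Suc (degree (q * p)). \<Sum>m<n. M r m * (coeff (q * p) l * X m l))"
      using step[OF that] by (simp add: sum_distrib_left mult_ac del: sum.lessThan_Suc)
    also have "\<dots> = (\<Sum>m<n. M r m * seq_comb X (q * p) m)"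
      unfolding seq_comb_def by (subst sum.swap) (simp add: sum_distrib_left lessThan_Suc_atMost)
    also have "\<dots> = 0"
      using pCons.IH by (simp add: annihilates_def)
    finally show ?thesis .
  qed
  then show ?case
    using assms by (simp add: annihilates_def seq_comb_add seq_comb_smult)
qed

text \<open>The first \<open>n + 1\<close> columns are dependent, which gives an annihilator of
  degree at most \<open>n\<close>. One of least degree divides all others, by division with
  remainder; its root at 0 is split off as \<open>monom 1 s\<close>.\<close>

lemma minimal_annihilator:
  obtains s q where "poly q 0 \<noteq> 0" "s + degree q \<le> n" "annihilates X n (monom 1 s * q)"
    "\<And>p. annihilates X n p \<Longrightarrow> monom 1 s * q dvd p"
proof -
  obtain x where x: "\<exists>a<Suc n. x a \<noteq> 0" "\<And>e. e < n \<Longrightarrow> (\<Sum>a<Suc n. X e a * x a) = 0"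
    using wide_kernel[of n "Suc n" X] by blast
  define f0 where "f0 = seq_poly (Suc n) x"
  have "f0 \<noteq> 0"
    using x(1) by (auto simp: f0_def poly_eq_iff coeff_seq_poly)
  moreover have "annihilates X n f0"
    using x(2) seq_comb_seq_poly[of X 0 "Suc n" x]
    by (simp add: annihilates_def f0_def del: sum.lessThan_Suc)
  ultimately obtain f where f: "f \<noteq> 0" "annihilates X n f"
    and least: "\<And>g. g \<noteq> 0 \<Longrightarrow> annihilates X n g \<Longrightarrow> degree f \<le> degree g"
    using ex_has_least_nat[of "\<lambda>f. f \<noteq> 0 \<and> annihilates X n f" f0 degree] by auto
  have deg_f: "degree f \<le> n"
  proof -
    have "degree f0 \<le> n"
      by (rule degree_le) (simp add: f0_def coeff_seq_poly)
    then show ?thesis using least[OF \<open>f0 \<noteq> 0\<close> \<open>annihilates X n f0\<close>] by simp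
  qed
  define s where "s = order 0 f"
  obtain q where q: "f = [:- 0, 1:] ^ s * q" "\<not> [:- 0, 1:] dvd q"
    using order_decomp[OF f(1), of 0] unfolding s_def by blast
  have fq: "f = monom 1 s * q"
    using q(1) by (simp add: monom_altdef)
  have "q \<noteq> 0" using f(1) fq by auto
  then have "degree f = s + degree q"
    by (simp add: fq degree_mult_eq degree_monom_eq monom_eq_0_iff)
  show ?thesis
  proof
    show "poly q 0 \<noteq> 0"
      using q(2) poly_eq_0_iff_dvd[of q 0] by simp
    show "s + degree q \<le> n"
      using deg_f \<open>degree f = _\<close> by simp
    show "annihilates X n (monom 1 s * q)"
      using f(2) fq by simp
    fix p assume "annihilates X n p"
    moreover have "p mod f = p - (p div f) * f"
      by (simp add: minus_div_mult_eq_mod)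
    ultimately have "annihilates X n (p mod f)"
      using annihilates_mult[OF f(2), of "p div f"] by (simp add: annihilates_def seq_comb_diff)
    then have "p mod f = 0"
      using least[of "p mod f"] degree_mod_less'[OF f(1), of p] by fastforce
    then show "monom 1 s * q dvd p"
      using fq by (simp add: dvd_eq_mod_eq_0)
  qed
qed

text \<open>Modulo \<open>monom 1 s * q\<close>, every \<open>monom 1 l\<close> with
  \<open>s \<le> l\<close> reduces to \<open>monom 1 s\<close> times a remainder modulo
  \<open>q\<close>. So all columns from \<open>s\<close> on are combinations of
  \<open>degree q\<close> of them, and \<open>s \<le> n - degree q\<close>.\<close>

lemma minor_many_above:
  assumes ann: "annihilates X n (monom 1 s * q)" and s: "s + degree q \<le> n" and "q \<noteq> 0"
    and cs: "sorted_wrt (<) cs" "\<not> few_above (n - degree q) (degree q) cs"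
    and rs: "rs \<in> incr_lists n (length cs)"
  shows "minor X rs cs = 0"
proof -
  define d m where "d = degree q" and "m = n - degree q"
  define g where "g l = monom 1 (l - s) mod q" for l
  have coeff_g: "coeff (g l) e = 0" if "d \<le> e" for l e
    using that degree_mod_less[OF \<open>q \<noteq> 0\<close>, of "monom 1 (l - s)"]
    by (auto simp: g_def d_def intro: coeff_eq_0)
  have X: "X r l = (\<Sum>e<d. coeff (g l) e * X r (s + e))" if "s \<le> l" "r < n" for r l
  proof -
    have "monom 1 l = monom 1 s * (monom 1 (l - s) :: 'a poly)"
      using that by (simp add: mult_monom)
    moreover have "monom 1 (l - s) - g l = (monom 1 (l - s) div q) * q"
      by (simp add: g_def minus_mod_eq_div_mult)
    ultimately have "monom 1 l - monom 1 s * g l = (monom 1 (l - s) div q) * (monom 1 s * q)"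
      by (metis mult.left_commute right_diff_distrib)
    then have "seq_comb X (monom 1 l * 1 - monom 1 s * g l) r = 0"
      using annihilates_mult[OF ann, of "monom 1 (l - s) div q"] that(2)
      by (simp add: annihilates_def)
    then have "seq_comb X (monom 1 l * 1) r = seq_comb X (monom 1 s * g l) r"
      by (simp add: seq_comb_diff)
    then show ?thesis
      using seq_comb_monom_mult[of d "g l" X s r] coeff_g seq_comb_monom_mult[of 1 1 X l r]
      by simp
  qed
  define T1 T2 where "T1 = takeWhile (\<lambda>l. l < m) cs" and "T2 = dropWhile (\<lambda>l. l < m) cs"
  have T: "cs = T1 @ T2" by (simp add: T1_def T2_def)
  have T1: "\<forall>l\<in>set T1. l < m" by (auto simp: T1_def dest: set_takeWhileD)
  have T2: "\<forall>l\<in>set T2. m \<le> l"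
  proof (cases T2)
    case (Cons l ls)
    then have "\<not> l < m" using hd_dropWhile[of "\<lambda>l. l < m" cs] by (simp add: T2_def)
    then show ?thesis using cs(1) Cons unfolding T by (fastforce simp: sorted_wrt_append)
  qed simp
  have "filter ((\<le>) m) cs = T2"
    using T1 T2 by (auto simp: T filter_empty_conv intro!: filter_True)
  then have "d < length T2"
    using cs(2) by (simp add: few_above_def d_def m_def)
  \<comment> \<open>More than \<open>d\<close> columns are described by \<open>d\<close>
    coefficients each, so in some nontrivial combination all coefficients cancel.\<close>
  then obtain y where y: "\<exists>a<length T2. y a \<noteq> 0"
    "\<And>e. e < d \<Longrightarrow> (\<Sum>a<length T2. coeff (g (T2 ! a)) e * y a) = 0"
    using wide_kernel[of d "length T2" "\<lambda>e a. coeff (g (T2 ! a)) e"] by blast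
  then obtain a where a: "a < length T2" "y a \<noteq> 0" by blast
  \<comment> \<open>The relation among the late columns \<open>T2\<close> is extended by 0 to the
    early ones.\<close>
  define x where "x a = (if a < length T1 then 0 else y (a - length T1))" for a
  have len: "length rs = length T1 + length T2"
    using rs T by (simp add: incr_lists_def)
  show ?thesis
  proof (rule minor_dependent_cols)
    show "length cs = length rs" "length T1 + a < length rs" "x (length T1 + a) \<noteq> 0"
      using len T a by (simp_all add: x_def)
    fix r assume "r \<in> set rs"
    then have r: "r < n" using rs by (auto simp: incr_lists_def)
    have "(\<Sum>a<length rs. X r (cs ! a) * x a) = (\<Sum>a<length T2. X r (T2 ! a) * y a)"
      unfolding len by (subst sum_lessThan_shift) (auto simp: x_def T)
    also have "\<dots> = (\<Sum>a<length T2. \<Sum>e<d. X r (s + e) * (coeff (g (T2 ! a)) e * y a))"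
    proof (rule sum.cong[OF refl])
      fix a assume "a \<in> {..<length T2}"
      then have "m \<le> T2 ! a" using T2 by simp
      then have "s \<le> T2 ! a" using s by (simp add: m_def)
      then show "X r (T2 ! a) * y a = (\<Sum>e<d. X r (s + e) * (coeff (g (T2 ! a)) e * y a))"
        by (subst X[OF \<open>s \<le> T2 ! a\<close> r]) (simp add: sum_distrib_left mult_ac)
    qed
    also have "\<dots> = (\<Sum>e<d. X r (s + e) * (\<Sum>a<length T2. coeff (g (T2 ! a)) e * y a))"
      by (subst sum.swap) (simp add: sum_distrib_left)
    also have "\<dots> = 0" using y(2) by simp
    finally show "(\<Sum>a<length rs. X r (cs ! a) * x a) = 0" .
  qed
qed

text \<open>A relation in the window is an annihilator \<open>monom 1 i * p\<close> with
  \<open>degree p < j\<close>. If \<open>j \<le> degree q\<close>, then \<open>q\<close> divides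
  \<open>p\<close>, because \<open>q\<close> is prime to the variable, and \<open>p = 0\<close> by
  degree. Otherwise the window ends before index \<open>n\<close>, and multiplication by a power of
  the variable moves the relation to the window starting at \<open>n - j\<close>, which is
  independent by \<open>rank\<close>.\<close>

lemma indep_window_of_few_above:
  assumes min: "\<And>p. annihilates X n p \<Longrightarrow> monom 1 s * q dvd p" and q: "poly q 0 \<noteq> 0"
    and s: "s + degree q \<le> n"
    and rank: "indep_window X n (n - j) j"
    and few: "few_above (n - degree q) (degree q) [i..<i + j]"
  shows "indep_window X n i j"
  unfolding indep_window_def
proof (intro allI impI)
  fix x a assume x: "\<forall>r<n. (\<Sum>a<j. X r (i + a) * x a) = 0" and "a < j"
  define p where "p = seq_poly j x"
  have ann: "annihilates X n (monom 1 i * p)"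
    using x by (simp add: annihilates_def p_def seq_comb_seq_poly)
  show "x a = 0"
  proof (cases "j \<le> degree q")
    case True
    have cancel: "q dvd p'" if "q dvd monom 1 i * p'" for p' i
      using that
    proof (induction i)
      case (Suc i)
      then have "q dvd pCons 0 (monom 1 i * p')" by (simp add: monom_Suc)
      then obtain h where h: "pCons 0 (monom 1 i * p') = q * h" by (elim dvdE)
      then have "poly q 0 * poly h 0 = 0"
        by (metis poly_mult poly_pCons mult_zero_left add_0)
      then obtain h' where "h = pCons 0 h'"
        using q by (cases h) auto
      then have "monom 1 i * p' = q * h'" using h by simp
      then show ?case using Suc.IH by simp
    qed (simp add: monom_0)
    have "q dvd p"
      using min[OF ann] cancel by (meson dvd_mult_right)
    moreover have "degree p < j"
      unfolding p_def by (rule degree_lessI) (use \<open>a < j\<close> in \<open>auto simp: coeff_seq_poly\<close>)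
    ultimately have "p = 0"
      using True dvd_imp_degree_le[of q p] by auto
    then show ?thesis
      using coeff_seq_poly[of j x a] \<open>a < j\<close> by (simp add: p_def)
  next
    case False
    have "length (filter ((\<le>) (n - degree q)) [i..<i + j]) = i + j - max (n - degree q) i"
    proof -
      have "{l. n - degree q \<le> l} \<inter> {i..<i + j} = {max (n - degree q) i..<i + j}" by auto
      then show ?thesis by (simp add: distinct_length_filter)
    qed
    \<comment> \<open>A window entirely above \<open>n - degree q\<close> would have
      \<open>j > degree q\<close> entries there. So it starts below, and its upper part has
      \<open>i + j - (n - degree q) \<le> degree q\<close> entries.\<close>
    then have "i + j \<le> n"
      using few False s by (auto simp: few_above_def max_def split: if_splits)
    then have eq: "monom 1 (n - j) * p = monom 1 (n - j - i) * (monom 1 i * p)"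
      by (simp add: mult_monom flip: mult.assoc)
    have "annihilates X n (monom 1 (n - j) * p)"
      unfolding eq by (rule annihilates_mult[OF ann])
    then show ?thesis
      using rank \<open>a < j\<close> unfolding indep_window_def annihilates_def p_def seq_comb_seq_poly by blast
  qed
qed

end

theorem recursion_minors_nonneg:
  fixes M X :: "nat \<Rightarrow> nat \<Rightarrow> real"
  assumes "linear_recursion n M X" and "k \<le> n"
    and M: "\<And>j rs cs. \<lbrakk>j \<le> k; rs \<in> incr_lists n j; cs \<in> incr_lists n j\<rbrakk> \<Longrightarrow> 0 \<le> minor M rs cs"
    and start: "\<And>j rs. \<lbrakk>j \<le> k; rs \<in> incr_lists n j\<rbrakk> \<Longrightarrow> 0 \<le> minor X rs [0..<j]"
    and rank: "\<And>j. \<lbrakk>1 \<le> j; j < k\<rbrakk> \<Longrightarrow> indep_window X n (n - j) j"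
    and "j \<le> k" "rs \<in> incr_lists n j" "sorted_wrt (<) cs" "length cs = j"
  shows "0 \<le> minor X rs cs"
proof -
  interpret linear_recursion n M X by fact
  obtain s q where q: "poly q 0 \<noteq> 0" and s: "s + degree q \<le> n"
    and ann: "annihilates X n (monom 1 s * q)"
    and min: "\<And>p. annihilates X n p \<Longrightarrow> monom 1 s * q dvd p"
    using minimal_annihilator by blast
  \<comment> \<open>The window moved by one is \<open>M\<close> times the window, so Cauchy--Binet
    carries nonnegativity along.\<close>
  have window: "0 \<le> minor X rs [a..<a + j]" if "j \<le> k" "rs \<in> incr_lists n j" for a j rs
    using that
  proof (induction a arbitrary: rs)
    case 0
    then show ?case using start by simp
  next
    case (Suc a)
    then have len: "length [a..<a + j] = length rs" by (simp add: incr_lists_def)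
    have "minor X rs [Suc a..<Suc a + j] = minor (\<lambda>r c. \<Sum>m<n. M r m * X m c) rs [a..<a + j]"
    proof (rule minor_cong)
      fix i b assume "i < length rs" "b < length rs"
      moreover from this have "rs ! i < n"
        using Suc.prems(2) nth_mem by (fastforce simp: incr_lists_def)
      ultimately show "X (rs ! i) ([Suc a..<Suc a + j] ! b) =
          (\<Sum>m<n. M (rs ! i) m * X m ([a..<a + j] ! b))"
        using step len by (simp del: upt_Suc)
    qed (use len in \<open>simp_all del: upt_Suc\<close>)
    also have "\<dots> = (\<Sum>N\<in>incr_lists n j. minor M rs N * minor X N [a..<a + j])"
      using Cauchy_Binet[OF len, of M X n] Suc.prems(2) by (simp add: incr_lists_def)
    also have "\<dots> \<ge> 0"
      using Suc M by (intro sum_nonneg mult_nonneg_nonneg) auto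
    finally show ?case .
  qed
  show ?thesis
  proof (rule minors_nonneg_of_windows[where m = "n - degree q" and d = "degree q" and k = k and n = n])
    show "0 \<le> minor X rs [a..<a + j]" if "j \<le> k" "rs \<in> incr_lists n j" for j a rs
      using that by (rule window)
  next
    fix j a assume j: "j < k" and few: "few_above (n - degree q) (degree q) [a..<a + j]"
    have "indep_window X n (n - j) j"
    proof (cases "j = 0")
      case True
      then show ?thesis by (simp add: indep_window_def)
    next
      case False
      then show ?thesis using rank j by simp
    qed
    have "indep_window X n a j"
    proof (rule indep_window_of_few_above[where s = s and q = q])
      show "monom 1 s * q dvd p" if "annihilates X n p" for p
        using that by (rule min)
    qed fact+
    then show "\<exists>rs\<in>incr_lists n j. minor X rs [a..<a + j] \<noteq> 0"
      by (rule indep_window_minor)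
  next
    fix rs cs assume "sorted_wrt (<) cs" "\<not> few_above (n - degree q) (degree q) cs"
      "rs \<in> incr_lists n (length cs)"
    moreover have "q \<noteq> 0" using q by auto
    ultimately show "minor X rs cs = 0"
      by (intro minor_many_above[OF ann s])
  qed fact+
qed

section \<open>Controllability and observability matrices\<close>

text \<open>Exactly \<open>a\<close> entries of an increasing list are smaller than its entry
  \<open>a\<close>, and \<open>pick\<close> is determined by that count.\<close>

lemma pick_nth:
  assumes "sorted_wrt (<) xs" "a < length xs"
  shows "pick (set xs) a = xs ! a"
proof -
  have xs: "sorted xs" "distinct xs" using assms(1) by (auto simp: strict_sorted_iff)
  have "xs ! i < xs ! a \<longleftrightarrow> i < a" if "i < length xs" for i
    using sorted_wrt_nth_less[OF assms(1), of i a] sorted_wrt_nth_less[OF assms(1), of a i] assms(2) that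
    by (cases i a rule: linorder_cases) auto
  then have "{x \<in> set xs. x < xs ! a} = nth xs ` {0..<a}"
    using assms(2) by (auto simp: in_set_conv_nth image_iff Bex_def) (metis less_trans)
  then have "{x \<in> set xs. x < xs ! a} = set (take a xs)"
    using nth_image[of a xs] assms(2) by simp
  then have "card {x \<in> set xs. x < xs ! a} = a"
    using assms(2) xs(2) by (simp add: distinct_card)
  then show ?thesis
    using pick_card_in_set[of "xs ! a" "set xs"] assms(2) by simp
qed

abbreviation mat_fun :: "'a mat \<Rightarrow> nat \<Rightarrow> nat \<Rightarrow> 'a" where
  "mat_fun X \<equiv> \<lambda>r c. X $$ (r, c)"

lemma det_submatrix_eq_minor:
  assumes "rs \<in> incr_lists (dim_row X) j" "cs \<in> incr_lists (dim_col X) j"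
  shows "det (submatrix X (set rs) (set cs)) = minor (mat_fun X) rs cs"
proof -
  have *: "card {i. i < n \<and> i \<in> set xs} = j" if "xs \<in> incr_lists n j" for xs n
  proof -
    have "{i. i < n \<and> i \<in> set xs} = set xs" using incr_listsD[OF that] by auto
    then show ?thesis using incr_listsD[OF that] by (simp add: distinct_card)
  qed
  show ?thesis
    unfolding submatrix_def minor_def using assms[THEN *] incr_listsD[OF assms(1)] incr_listsD[OF assms(2)]
    by (intro arg_cong[of _ _ det] eq_matI) (auto simp: pick_nth)
qed

lemma set_incr_lists: "set ` incr_lists n j = {I. I \<subseteq> {0..<n} \<and> card I = j}"
proof (intro equalityI subsetI)
  fix I assume "I \<in> {I. I \<subseteq> {0..<n} \<and> card I = j}"
  moreover from this have "finite I" using finite_subset by auto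
  ultimately have "sorted_list_of_set I \<in> incr_lists n j" "set (sorted_list_of_set I) = I"
    by (auto simp: incr_lists_def)
  then show "I \<in> set ` incr_lists n j" by (metis imageI)
next
  fix I assume "I \<in> set ` incr_lists n j"
  then show "I \<in> {I. I \<subseteq> {0..<n} \<and> card I = j}"
    using incr_listsD[of _ n j] by (auto simp: distinct_card subset_iff)
qed

text \<open>The enumeration \<open>lex_subsets\<close> runs through every subset, so quantifying
  over its indices amounts to quantifying over increasing lists.\<close>

lemma nonneg_compound_mat_iff:
  "nonneg_mat (compound_mat j X) \<longleftrightarrow>
    (\<forall>rs\<in>incr_lists (dim_row X) j. \<forall>cs\<in>incr_lists (dim_col X) j. 0 \<le> minor (mat_fun X) rs cs)"
proof -
  let ?S = "\<lambda>n. {I. I \<subseteq> {0..<n} \<and> card I = j}"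
  have range: "(\<forall>i<n choose j. P (set (lex_subsets n j ! i))) \<longleftrightarrow> (\<forall>I\<in>?S n. P I)" for n P
    unfolding set_lex_subsets[symmetric] by (simp add: all_set_conv_all_nth length_lex_subsets)
  have "nonneg_mat (compound_mat j X) \<longleftrightarrow>
      (\<forall>i<dim_row X choose j. \<forall>l<dim_col X choose j.
        0 \<le> det (submatrix X (set (lex_subsets (dim_row X) j ! i)) (set (lex_subsets (dim_col X) j ! l))))"
    by (auto simp: nonneg_mat_def compound_mat_def less_eq_mat_def)
  also have "\<dots> \<longleftrightarrow> (\<forall>I\<in>?S (dim_row X). \<forall>l<dim_col X choose j.
        0 \<le> det (submatrix X I (set (lex_subsets (dim_col X) j ! l))))"
    by (rule range)
  also have "\<dots> \<longleftrightarrow> (\<forall>I\<in>?S (dim_row X). \<forall>J\<in>?S (dim_col X). 0 \<le> det (submatrix X I J))"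
    by (intro ball_cong refl range)
  also have "\<dots> \<longleftrightarrow> (\<forall>rs\<in>incr_lists (dim_row X) j. \<forall>cs\<in>incr_lists (dim_col X) j.
      0 \<le> minor (mat_fun X) rs cs)"
    unfolding set_incr_lists[symmetric] by (simp add: det_submatrix_eq_minor)
  finally show ?thesis .
qed

lemma nonneg_compound_mat_transpose:
  "nonneg_mat (compound_mat j (transpose_mat X)) \<longleftrightarrow> nonneg_mat (compound_mat j X)"
proof -
  have "minor (mat_fun (transpose_mat X)) rs cs = minor (mat_fun X) cs rs"
    if "rs \<in> incr_lists (dim_col X) j" "cs \<in> incr_lists (dim_row X) j" for rs cs
  proof -
    have "minor (mat_fun (transpose_mat X)) rs cs = minor (\<lambda>a b. X $$ (b, a)) rs cs"
      using incr_listsD[OF that(1)] incr_listsD[OF that(2)]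
      by (intro minor_cong) (auto simp: subset_iff)
    then show ?thesis
      using minor_transpose[of rs cs "mat_fun X"] incr_listsD[OF that(1)] incr_listsD[OF that(2)] by simp
  qed
  then show ?thesis
    unfolding nonneg_compound_mat_iff by auto
qed

lemma k_positive_transpose: "k_positive k (transpose_mat X) \<longleftrightarrow> k_positive k X"
  by (simp add: k_positive_def nonneg_compound_mat_transpose min.commute)

section \<open>Full rank expressed by kernels\<close>

lemma (in vec_space) rank_eq_card_basis:
  assumes "A \<in> carrier_mat n nc"
  obtains S where "S \<subseteq> set (cols A)" "lin_indpt S" "rank A = card S"
proof -
  have "lin_indpt {}" by (simp add: lin_dep_def)
  then obtain S where S: "maximal S (\<lambda>T. T \<subseteq> set (cols A) \<and> lin_indpt T)"
    using maximal_exists_superset[of "set (cols A)" "\<lambda>T. T \<subseteq> set (cols A) \<and> lin_indpt T" "{}"] by auto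
  show ?thesis
    by (rule that[of S]) (use S rank_card_indpt[OF assms S] in \<open>simp_all add: maximal_def\<close>)
qed

text \<open>Independence is a property of the set of columns, so equal columns are treated apart:
  full rank leaves no room for them, and a trivial kernel excludes them because it would contain a
  difference of two unit vectors.\<close>

lemma (in vec_space) full_column_rank_iff:
  assumes A: "A \<in> carrier_mat n nc"
  shows "rank A = nc \<longleftrightarrow> (\<forall>v\<in>carrier_vec nc. A *\<^sub>v v = 0\<^sub>v n \<longrightarrow> v = 0\<^sub>v nc)"
proof
  assume rank: "rank A = nc"
  have "distinct (cols A)"
  proof (rule card_distinct, rule antisym[OF card_length])
    obtain S where "S \<subseteq> set (cols A)" "rank A = card S"
      using rank_eq_card_basis[OF A] .
    then show "length (cols A) \<le> card (set (cols A))"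
      using rank A card_mono[of "set (cols A)" S] by simp
  qed
  then show "\<forall>v\<in>carrier_vec nc. A *\<^sub>v v = 0\<^sub>v n \<longrightarrow> v = 0\<^sub>v nc"
    using lin_depI[OF A] full_rank_lin_indpt[OF A rank] by blast
next
  assume ker: "\<forall>v\<in>carrier_vec nc. A *\<^sub>v v = 0\<^sub>v n \<longrightarrow> v = 0\<^sub>v nc"
  have "distinct (cols A)"
  proof (rule ccontr)
    assume "\<not> distinct (cols A)"
    then obtain a b where ab: "a < nc" "b < nc" "a \<noteq> b" "col A a = col A b"
      using A by (auto simp: distinct_conv_nth)
    let ?v = "unit_vec nc a - unit_vec nc b :: 'a vec"
    have "A $$ (r, a) = A $$ (r, b)" if "r < n" for r
    proof -
      have "col A a $ r = col A b $ r" by (simp only: ab(4))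
      then show ?thesis using ab(1,2) A that by simp
    qed
    then have "A *\<^sub>v ?v = 0\<^sub>v n"
      using A ab by (intro eq_vecI) (auto simp: scalar_prod_minus_distrib[of _ nc] scalar_prod_right_unit)
    then have "?v = 0\<^sub>v nc"
      using ker by simp
    then have "?v $ a = 0" using ab by simp
    then show False using ab by simp
  qed
  moreover have "lin_indpt (set (cols A))"
    using lin_depE[OF A _ calculation] ker by blast
  ultimately show "rank A = nc"
    by (rule lin_indpt_full_rank[OF A])
qed

lemma kernel_trivial_iff_indep_window:
  fixes B :: "'a :: comm_ring_1 mat"
  assumes B: "B \<in> carrier_mat n j"
    and ent: "\<And>r l. r < n \<Longrightarrow> l < j \<Longrightarrow> B $$ (r, l) = X r (i + l)"
  shows "(\<forall>v\<in>carrier_vec j. B *\<^sub>v v = 0\<^sub>v n \<longrightarrow> v = 0\<^sub>v j) \<longleftrightarrow> indep_window X n i j"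
proof -
  have mult: "B *\<^sub>v v = 0\<^sub>v n \<longleftrightarrow> (\<forall>r<n. (\<Sum>a<j. X r (i + a) * v $ a) = 0)"
    if "v \<in> carrier_vec j" for v
    using B that ent by (auto simp: vec_eq_iff scalar_prod_def lessThan_atLeast0)
  show ?thesis
    unfolding indep_window_def
  proof (intro iffI allI impI ballI)
    fix x a
    assume ker: "\<forall>v\<in>carrier_vec j. B *\<^sub>v v = 0\<^sub>v n \<longrightarrow> v = 0\<^sub>v j"
      and x: "\<forall>r<n. (\<Sum>a<j. X r (i + a) * x a) = 0" and a: "a < j"
    have "B *\<^sub>v vec j x = 0\<^sub>v n"
      using x by (subst mult) auto
    then have "vec j x = 0\<^sub>v j" using ker by simp
    then have "vec j x $ a = 0" using a by simp
    then show "x a = 0" using a by simp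
  next
    fix v
    assume indep: "\<forall>x. (\<forall>r<n. (\<Sum>a<j. X r (i + a) * x a) = 0) \<longrightarrow> (\<forall>a<j. x a = 0)"
      and v: "v \<in> carrier_vec j" "B *\<^sub>v v = 0\<^sub>v n"
    then have "\<forall>a<j. v $ a = 0"
      using mult[OF v(1)] by blast
    then show "v = 0\<^sub>v j"
      using v(1) by (intro eq_vecI) auto
  qed
qed

text \<open>\<open>rank\<close> is the column rank, and this moves the observability condition to
  the transpose. If \<open>D\<close> has rank \<open>j\<close>, some \<open>j\<close> columns form
  an invertible \<open>E\<close>, and a vector killed by \<open>transpose_mat D\<close> is
  orthogonal to them. Conversely, independent columns of the transpose have a nonzero minor of order
  \<open>j\<close>, which bounds the rank of \<open>D\<close> from below.\<close>

lemma full_row_rank_iff: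
  fixes D :: "real mat"
  assumes D: "D \<in> carrier_mat j n"
  shows "vec_space.rank j D = j \<longleftrightarrow> vec_space.rank n (transpose_mat D) = j"
proof -
  interpret J: vec_space "TYPE(real)" j .
  interpret N: vec_space "TYPE(real)" n .
  have DT: "transpose_mat D \<in> carrier_mat n j" using D by simp
  show ?thesis
    unfolding N.full_column_rank_iff[OF DT]
  proof (intro iffI ballI impI)
    fix v :: "real vec"
    assume rank: "J.rank D = j" and v: "v \<in> carrier_vec j" "transpose_mat D *\<^sub>v v = 0\<^sub>v n"
    obtain S where S: "S \<subseteq> set (cols D)" "J.lin_indpt S" "J.rank D = card S"
      using J.rank_eq_card_basis[OF D] .
    have "finite S" using S(1) finite_subset by auto
    then obtain ss where ss: "set ss = S" "distinct ss"
      using finite_distinct_list by auto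
    have len: "length ss = j"
      using S(3) rank ss distinct_card by metis
    have car: "set ss \<subseteq> carrier_vec j"
      using S(1) ss(1) cols_dim[of D] D by auto
    define E where "E = mat_of_cols j ss"
    have E: "E \<in> carrier_mat j j" "cols E = ss"
      using car len by (auto simp: E_def)
    have "J.rank E = j"
      using J.lin_indpt_full_rank[OF E(1)] E(2) ss S(2) by simp
    then have "det E \<noteq> 0"
      using J.det_rank_iff[OF E(1)] by simp
    then have "det (transpose_mat E) \<noteq> 0"
      using det_transpose[OF E(1)] by simp
    moreover have "transpose_mat E *\<^sub>v v = 0\<^sub>v j"
    proof (rule eq_vecI)
      fix a assume "a < dim_vec (0\<^sub>v j :: real vec)"
      then have a: "a < j" by simp
      then have "ss ! a \<in> set (cols D)" using S(1) ss(1) len nth_mem by blast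
      then obtain l where l: "l < n" "ss ! a = col D l"
        using D by (auto simp: in_set_conv_nth)
      have "(transpose_mat E *\<^sub>v v) $ a = col E a \<bullet> v"
        using a E by simp
      also have "col E a = col D l"
        using a l E len by (metis cols_nth carrier_matD(2))
      also have "col D l \<bullet> v = (transpose_mat D *\<^sub>v v) $ l"
        using l D by simp
      finally show "(transpose_mat E *\<^sub>v v) $ a = 0\<^sub>v j $ a"
        using v(2) l a by simp
    qed (use E in simp)
    ultimately show "v = 0\<^sub>v j"
      using det_0_iff_vec_prod_zero_field[of "transpose_mat E" j] E v(1) by auto
  next
    assume ker: "\<forall>v\<in>carrier_vec j. transpose_mat D *\<^sub>v v = 0\<^sub>v n \<longrightarrow> v = 0\<^sub>v j"
    have "indep_window (\<lambda>r l. D $$ (l, r)) n 0 j"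
      using kernel_trivial_iff_indep_window[OF DT, of "\<lambda>r l. D $$ (l, r)" 0] ker D by simp
    from indep_window_minor[OF this]
    obtain rs where rs: "rs \<in> incr_lists n j" "minor (\<lambda>r l. D $$ (l, r)) rs [0..<j] \<noteq> 0"
      unfolding add_0 by blast
    have cs: "[0..<j] \<in> incr_lists j j"
      by (auto simp: incr_lists_def)
    have "det (submatrix D (set [0..<j]) (set rs)) \<noteq> 0"
      using det_submatrix_eq_minor[of "[0..<j]" D j rs] minor_transpose[of rs "[0..<j]" "mat_fun D"]
        rs cs D incr_listsD(3)[OF rs(1)] by simp
    then have "card {c. c < n \<and> c \<in> set rs} \<le> J.rank D"
      by (rule J.rank_gt_minor[OF D])
    moreover have "{c. c < n \<and> c \<in> set rs} = set rs"
      using incr_listsD(2)[OF rs(1)] by auto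
    ultimately have "j \<le> J.rank D"
      using incr_listsD[OF rs(1)] by (simp add: distinct_card)
    moreover have "J.rank D \<le> j"
    proof -
      obtain S where S: "S \<subseteq> set (cols D)" "J.lin_indpt S" "J.rank D = card S"
        using J.rank_eq_card_basis[OF D] .
      then have "S \<subseteq> carrier_vec j"
        using cols_dim[of D] D by auto
      then show ?thesis
        using J.li_le_dim(2)[OF J.fin_dim _ S(2)] S(3) by (simp add: J.dim_is_n)
    qed
    ultimately show "J.rank D = j" by simp
  qed
qed

section \<open>Krylov sequences and positivity of the two matrices\<close>

definition krylov :: "'a :: semiring_1 mat \<Rightarrow> 'a vec \<Rightarrow> nat \<Rightarrow> nat \<Rightarrow> 'a" where
  "krylov A b r l = (A ^\<^sub>m l *\<^sub>v b) $ r"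

lemma pow_mat_add:
  assumes "A \<in> carrier_mat n n"
  shows "A ^\<^sub>m (i + l) = A ^\<^sub>m i * A ^\<^sub>m l"
  using assms
proof (induction l)
  case (Suc l)
  then show ?case using assoc_mult_mat[of "A ^\<^sub>m i" n n "A ^\<^sub>m l" n A n] by simp
next
  case 0
  then show ?case using right_mult_one_mat[of "A ^\<^sub>m i" n n] by simp
qed

lemma pow_mat_transpose:
  assumes "(A :: 'a :: comm_semiring_1 mat) \<in> carrier_mat n n"
  shows "transpose_mat (A ^\<^sub>m i) = transpose_mat A ^\<^sub>m i"
proof (induction i)
  case (Suc i)
  have "transpose_mat (A ^\<^sub>m Suc i) = transpose_mat A * transpose_mat A ^\<^sub>m i"
    using assms Suc transpose_mult[of "A ^\<^sub>m i" n n A n] by simp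
  also have "\<dots> = transpose_mat A ^\<^sub>m (1 + i)"
    using assms by (subst pow_mat_add[of _ n]) auto
  finally show ?case by simp
next
  case 0
  then show ?case using assms by simp
qed

lemma linear_recursion_krylov:
  fixes A :: "'a :: field mat"
  assumes A: "A \<in> carrier_mat n n" and b: "b \<in> carrier_vec n"
  shows "linear_recursion n (mat_fun A) (krylov A b)"
proof
  fix r l assume r: "r < n"
  have "A ^\<^sub>m Suc l = A * A ^\<^sub>m l"
    using pow_mat_add[OF A, of 1 l] A by simp
  then have "A ^\<^sub>m Suc l *\<^sub>v b = A *\<^sub>v (A ^\<^sub>m l *\<^sub>v b)"
    using assoc_mult_mat_vec[OF A pow_carrier_mat[OF A] b] by simp
  then show "krylov A b r (Suc l) = (\<Sum>m<n. A $$ (r, m) * krylov A b m l)"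
    unfolding krylov_def using r A b by (simp add: scalar_prod_def lessThan_atLeast0 del: pow_mat.simps)
qed

lemma ctrb_mat_carrier: "A \<in> carrier_mat n n \<Longrightarrow> ctrb_mat t A b \<in> carrier_mat n t"
  using mat_of_cols_carrier(1)[of n "map (\<lambda>i. A ^\<^sub>m i *\<^sub>v b) [0..<t]"] by (simp add: ctrb_mat_def)

lemma ctrb_mat_index:
  assumes "A \<in> carrier_mat n n" "r < n" "l < t"
  shows "ctrb_mat t A b $$ (r, l) = krylov A b r l"
  using assms by (simp add: ctrb_mat_def mat_of_cols_index krylov_def)

lemma pow_mult_ctrb_mat_index:
  assumes A: "A \<in> carrier_mat n n" and b: "b \<in> carrier_vec n" and r: "r < n" and l: "l < t"
  shows "(A ^\<^sub>m i * ctrb_mat t A b) $$ (r, l) = krylov A b r (i + l)"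
proof -
  have "col (ctrb_mat t A b) l = A ^\<^sub>m l *\<^sub>v b"
    unfolding ctrb_mat_def using A b l by (subst col_mat_of_cols) (auto intro!: mult_mat_vec_carrier[of _ n n])
  then have "(A ^\<^sub>m i * ctrb_mat t A b) $$ (r, l) = (A ^\<^sub>m i *\<^sub>v (A ^\<^sub>m l *\<^sub>v b)) $ r"
    using A r l ctrb_mat_carrier[OF A, of t b] by simp
  also have "A ^\<^sub>m i *\<^sub>v (A ^\<^sub>m l *\<^sub>v b) = A ^\<^sub>m (i + l) *\<^sub>v b"
    using assoc_mult_mat_vec[of "A ^\<^sub>m i" n n "A ^\<^sub>m l" n b] A b by (simp add: pow_mat_add[OF A])
  finally show ?thesis by (simp add: krylov_def)
qed

lemma rank_ctrb_iff:
  fixes A :: "'a :: field mat"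
  assumes A: "A \<in> carrier_mat n n" and b: "b \<in> carrier_vec n"
  shows "vec_space.rank n (A ^\<^sub>m i * ctrb_mat j A b) = j \<longleftrightarrow> indep_window (krylov A b) n i j"
proof -
  interpret vec_space "TYPE('a)" n .
  have B: "A ^\<^sub>m i * ctrb_mat j A b \<in> carrier_mat n j"
    using A ctrb_mat_carrier[OF A] by (intro mult_carrier_mat[of _ n n]) auto
  show ?thesis
    unfolding full_column_rank_iff[OF B]
    by (rule kernel_trivial_iff_indep_window[OF B pow_mult_ctrb_mat_index[OF A b]])
qed

lemma rank_obsv_iff:
  fixes A :: "real mat"
  assumes A: "A \<in> carrier_mat n n" and c: "c \<in> carrier_vec n"
  shows "vec_space.rank j (obsv_mat j A c * A ^\<^sub>m i) = j \<longleftrightarrow>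
    vec_space.rank n (transpose_mat A ^\<^sub>m i * ctrb_mat j (transpose_mat A) c) = j"
proof -
  have C: "ctrb_mat j (transpose_mat A) c \<in> carrier_mat n j"
    using A by (intro ctrb_mat_carrier) simp
  have "transpose_mat (obsv_mat j A c * A ^\<^sub>m i) = transpose_mat A ^\<^sub>m i * ctrb_mat j (transpose_mat A) c"
    unfolding obsv_mat_def using C A by (subst transpose_mult) (auto simp: pow_mat_transpose)
  moreover have "obsv_mat j A c * A ^\<^sub>m i \<in> carrier_mat j n"
    unfolding obsv_mat_def using C A by (intro mult_carrier_mat[of _ _ n]) auto
  ultimately show ?thesis
    using full_row_rank_iff by metis
qed

lemma ctrb_mat_k_positive:
  fixes A :: "real mat"
  assumes A: "A \<in> carrier_mat n n" and b: "b \<in> carrier_vec n" and "k \<le> n"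
    and pos: "k_positive k A"
    and ctrb: "\<forall>j\<in>{1..k}. nonneg_mat (compound_mat j (ctrb_mat j A b))"
    and rank: "\<forall>j\<in>{1..k - 1}. vec_space.rank n (A ^\<^sub>m (n - j) * ctrb_mat j A b) = j"
    and "k \<le> t"
  shows "k_positive k (ctrb_mat t A b)"
proof -
  have dim: "dim_row (ctrb_mat t A b) = n" "dim_col (ctrb_mat t A b) = t" for t
    using ctrb_mat_carrier[OF A, of t b] by auto
  have eq: "minor (mat_fun (ctrb_mat t A b)) rs cs = minor (krylov A b) rs cs"
    if "rs \<in> incr_lists n j" "cs \<in> incr_lists t j" for rs cs j t
    using incr_listsD[OF that(1)] incr_listsD[OF that(2)] ctrb_mat_index[OF A]
    by (intro minor_cong) (auto simp: subset_iff)
  have "0 \<le> minor (krylov A b) rs cs" if j: "j \<le> k" and "rs \<in> incr_lists n j" "cs \<in> incr_lists t j" for j rs cs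
  proof (rule recursion_minors_nonneg[OF linear_recursion_krylov[OF A b] \<open>k \<le> n\<close>])
    fix i rs cs assume i: "i \<le> k" "rs \<in> incr_lists n i" "cs \<in> incr_lists n i"
    show "0 \<le> minor (mat_fun A) rs cs"
    proof (cases "i = 0")
      case False
      then have "nonneg_mat (compound_mat i A)" using pos i by (simp add: k_positive_def)
      then show ?thesis using i A by (simp add: nonneg_compound_mat_iff)
    qed (use i in \<open>simp add: incr_lists_def\<close>)
  next
    fix i rs assume i: "i \<le> k" "rs \<in> incr_lists n i"
    have upt: "[0..<i] \<in> incr_lists i i" by (auto simp: incr_lists_def)
    show "0 \<le> minor (krylov A b) rs [0..<i]"
    proof (cases "i = 0")
      case False
      then have "nonneg_mat (compound_mat i (ctrb_mat i A b))" using ctrb i by simp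
      then show ?thesis
        using i(2) upt eq[OF i(2) upt] unfolding nonneg_compound_mat_iff dim by metis
    qed (use i in \<open>simp add: incr_lists_def\<close>)
  next
    fix i assume "1 \<le> i" "i < k"
    then show "indep_window (krylov A b) n (n - i) i"
      using rank rank_ctrb_iff[OF A b] by auto
  qed (use that incr_listsD[OF that(3)] in auto)
  then show ?thesis
    using \<open>k \<le> n\<close> \<open>k \<le> t\<close> eq by (auto simp: k_positive_def nonneg_compound_mat_iff dim)
qed

text \<open>Duality: transposition turns observability of \<open>A\<close> into controllability of
  \<open>transpose_mat A\<close>.\<close>

lemma obsv_mat_k_positive:
  fixes A :: "real mat"
  assumes A: "A \<in> carrier_mat n n" and c: "c \<in> carrier_vec n" and "k \<le> n"
    and pos: "k_positive k A"
    and obsv: "\<forall>j\<in>{1..k}. nonneg_mat (compound_mat j (obsv_mat j A c))"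
    and rank: "\<forall>j\<in>{1..k - 1}. vec_space.rank j (obsv_mat j A c * A ^\<^sub>m (n - j)) = j"
    and "k \<le> t"
  shows "k_positive k (obsv_mat t A c)"
  unfolding obsv_mat_def k_positive_transpose
proof (rule ctrb_mat_k_positive[where n = n])
  show "k_positive k (transpose_mat A)"
    using pos by (simp add: k_positive_transpose)
  show "\<forall>j\<in>{1..k}. nonneg_mat (compound_mat j (ctrb_mat j (transpose_mat A) c))"
    using obsv by (simp add: obsv_mat_def nonneg_compound_mat_transpose)
  show "\<forall>j\<in>{1..k - 1}. vec_space.rank n (transpose_mat A ^\<^sub>m (n - j) * ctrb_mat j (transpose_mat A) c) = j"
    using rank by (simp only: rank_obsv_iff[OF A c])
qed (use A c \<open>k \<le> n\<close> \<open>k \<le> t\<close> in simp_all)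

section \<open>Transfer functions\<close>

text \<open>Roots may be repeated, so the linear factors are cancelled one at a time: each is prime
  and does not divide \<open>h\<close>.\<close>

lemma linear_factors_dvd_cancel:
  fixes h p :: "'a :: field poly"
  assumes "(\<Prod>a\<leftarrow>as. [:- a, 1:]) dvd h * p" "\<And>a. a \<in> set as \<Longrightarrow> poly h a \<noteq> 0"
  shows "(\<Prod>a\<leftarrow>as. [:- a, 1:]) dvd p"
  using assms
proof (induction as arbitrary: p)
  case (Cons a as)
  let ?R = "\<Prod>a\<leftarrow>as. [:- a, 1:]"
  have dvd: "[:- a, 1:] * ?R dvd h * p" using Cons.prems(1) by simp
  then have "[:- a, 1:] dvd h * p" by (rule dvd_mult_left)
  then have "poly p a = 0" using Cons.prems(2) by (simp flip: poly_eq_0_iff_dvd)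
  then have "[:- a, 1:] dvd p" by (simp add: poly_eq_0_iff_dvd)
  then obtain p' where p': "p = [:- a, 1:] * p'" by (elim dvdE)
  have "[:- a, 1:] * ?R dvd [:- a, 1:] * (h * p')"
    using dvd p' by (simp only: mult.left_commute)
  then have "?R dvd h * p'"
    by (simp only: dvd_mult_cancel_left) simp
  then have "?R dvd p'"
    by (rule Cons.IH) (use Cons.prems(2) in simp)
  then show ?case
    unfolding p' list.map prod_list.Cons by (rule mult_dvd_mono[OF dvd_refl])
qed simp

text \<open>Here \<open>y\<close> is the resolvent applied to the initial vector, with entries
  \<open>X r 0\<close>. As \<open>z - M\<close> divides \<open>z^i - M^i\<close>, it divides
  \<open>P(z) - P(M)\<close>, and \<open>P(M)\<close> kills the initial vector; hence
  \<open>P(z) y\<close> is the quotient applied to that vector.\<close>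

lemma (in linear_recursion) resolvent_polynomial:
  assumes ann: "annihilates X n P"
    and regular: "\<And>w. \<lbrakk>\<And>r. r < n \<Longrightarrow> (\<Sum>m<n. M r m * w m) = z * w r\<rbrakk> \<Longrightarrow> \<forall>r<n. w r = 0"
    and y: "\<And>r. r < n \<Longrightarrow> (\<Sum>m<n. M r m * y m) = z * y r - X r 0"
    and r: "r < n"
  shows "poly P z * y r = (\<Sum>i\<le>degree P. coeff P i * (\<Sum>l<i. z ^ (i - Suc l) * X r l))"
proof -
  \<comment> \<open>\<open>T\<close> is the quotient of \<open>z^i - M^i\<close> by
    \<open>z - M\<close>, and \<open>S\<close> that of \<open>P(z) - P(M)\<close>, each applied to
    the initial vector.\<close>
  define T where "T r i = (\<Sum>l<i. z ^ (i - Suc l) * X r l)" for r i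
  define S where "S r = (\<Sum>i\<le>degree P. coeff P i * T r i)" for r
  have T: "(\<Sum>m<n. M r m * T m i) = z * T r i + X r i - z ^ i * X r 0" if "r < n" for r i
  proof -
    have "(\<Sum>m<n. M r m * T m i) = (\<Sum>l<i. z ^ (i - Suc l) * X r (Suc l))"
      unfolding T_def sum_distrib_left step[OF that]
      by (subst sum.swap) (simp add: mult_ac)
    also have "\<dots> - z * T r i = (\<Sum>l<i. z ^ (i - Suc l) * X r (Suc l) - z ^ (i - l) * X r l)"
      unfolding T_def sum_distrib_left sum_subtractf[symmetric]
    proof (rule sum.cong[OF refl])
      fix l assume "l \<in> {..<i}"
      then have "z ^ (i - l) = z * z ^ (i - Suc l)" by (simp add: Suc_diff_Suc flip: power_Suc)
      then show "z ^ (i - Suc l) * X r (Suc l) - z * (z ^ (i - Suc l) * X r l) =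
          z ^ (i - Suc l) * X r (Suc l) - z ^ (i - l) * X r l" by simp
    qed
    also have "\<dots> = X r i - z ^ i * X r 0"
      using sum_lessThan_telescope[of "\<lambda>l. z ^ (i - l) * X r l" i] by simp
    finally show ?thesis by (simp add: algebra_simps)
  qed
  have S: "(\<Sum>m<n. M r m * S m) = z * S r - poly P z * X r 0" if "r < n" for r
  proof -
    have "(\<Sum>m<n. M r m * S m) = (\<Sum>i\<le>degree P. coeff P i * (\<Sum>m<n. M r m * T m i))"
      unfolding S_def sum_distrib_left by (subst sum.swap) (simp add: mult_ac)
    also have "\<dots> = (\<Sum>i\<le>degree P. coeff P i * (z * T r i + X r i - z ^ i * X r 0))"
      using T[OF that] by simp
    also have "\<dots> = z * S r + seq_comb X P r - poly P z * X r 0"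
      by (simp add: S_def seq_comb_def poly_altdef algebra_simps sum.distrib sum_subtractf
          sum_distrib_left)
    finally show ?thesis using ann that by (simp add: annihilates_def)
  qed
  \<comment> \<open>\<open>w\<close> solves the homogeneous equation, which has only the zero
    solution by \<open>regular\<close>.\<close>
  define w where "w r = poly P z * y r - S r" for r
  have "(\<Sum>m<n. M r m * w m) = z * w r" if "r < n" for r
  proof -
    have "(\<Sum>m<n. M r m * w m) = poly P z * (\<Sum>m<n. M r m * y m) - (\<Sum>m<n. M r m * S m)"
      by (simp add: w_def right_diff_distrib sum_subtractf sum_distrib_left mult.left_commute)
    also have "\<dots> = z * w r"
      unfolding y[OF that] S[OF that] by (simp add: w_def algebra_simps)
    finally show ?thesis .
  qed
  then have "w r = 0" using regular r by blast
  then show ?thesis by (simp add: w_def S_def T_def)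
qed

section \<open>Resolvents and poles of the transfer function\<close>

lemma not_eigenvalue_det:
  fixes A :: "'a :: field mat"
  assumes A: "A \<in> carrier_mat n n" and "\<not> eigenvalue A z"
  shows "det (z \<cdot>\<^sub>m 1\<^sub>m n - A) \<noteq> 0"
proof
  assume "det (z \<cdot>\<^sub>m 1\<^sub>m n - A) = 0"
  then obtain v where v: "v \<in> carrier_vec n" "v \<noteq> 0\<^sub>v n" "(z \<cdot>\<^sub>m 1\<^sub>m n - A) *\<^sub>v v = 0\<^sub>v n"
    using det_0_iff_vec_prod_zero_field[of "z \<cdot>\<^sub>m 1\<^sub>m n - A" n] A by (auto simp: minus_carrier_mat)
  have "A *\<^sub>v v = z \<cdot>\<^sub>v v"
  proof (rule eq_vecI)
    fix r assume r: "r < dim_vec (z \<cdot>\<^sub>v v)"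
    have "(z \<cdot>\<^sub>m 1\<^sub>m n - A) *\<^sub>v v = z \<cdot>\<^sub>v v - A *\<^sub>v v"
      using A v(1) by (subst minus_mult_distrib_mat_vec[of _ n n]) (auto intro!: eq_vecI)
    then have "(z \<cdot>\<^sub>v v - A *\<^sub>v v) $ r = 0\<^sub>v n $ r" by (simp only: v(3))
    then show "(A *\<^sub>v v) $ r = (z \<cdot>\<^sub>v v) $ r" using A v(1) r by simp
  qed (use A v in simp)
  then have "eigenvalue A z"
    using A v by (auto simp: eigenvalue_def eigenvector_def)
  then show False using assms(2) by simp
qed

lemma mat_inverse_of_det:
  fixes M :: "'a :: field mat"
  assumes M: "M \<in> carrier_mat n n" and "det M \<noteq> 0"
  obtains N where "mat_inverse M = Some N" "N \<in> carrier_mat n n" "M * N = 1\<^sub>m n" "N * M = 1\<^sub>m n"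
proof (cases "mat_inverse M")
  case None
  then show ?thesis
    using mat_inverse(1)[OF M, of "()"] det_non_zero_imp_unit[OF M assms(2), of "()"] by simp
next
  case (Some N)
  then show ?thesis using that mat_inverse(2)[OF M Some] by blast
qed

abbreviation cmat :: "real mat \<Rightarrow> complex mat" where
  "cmat \<equiv> map_mat complex_of_real"

abbreviation cvec :: "real vec \<Rightarrow> complex vec" where
  "cvec \<equiv> map_vec complex_of_real"

text \<open>States the resolvent formula through a solution \<open>y\<close> of a linear system. The
  form passes to the triple \<open>(transpose_mat A, c, b)\<close>, so one argument serves both rank
  conditions.\<close>

definition resolvent_form :: "nat \<Rightarrow> real mat \<Rightarrow> real vec \<Rightarrow> real vec \<Rightarrow> (complex \<Rightarrow> complex) \<Rightarrow> bool" where
  "resolvent_form n A b c G \<longleftrightarrow>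
    A \<in> carrier_mat n n \<and> b \<in> carrier_vec n \<and> c \<in> carrier_vec n \<and>
    (\<forall>z. \<not> eigenvalue (cmat A) z \<longrightarrow>
      (\<exists>y\<in>carrier_vec n. (z \<cdot>\<^sub>m 1\<^sub>m n - cmat A) *\<^sub>v y = cvec b \<and> G z = cvec c \<bullet> y))"

text \<open>For the transposed triple, the scalar \<open>c N b\<close> equals its transpose, and the
  transpose of \<open>N\<close> inverts the transposed matrix.\<close>

lemma realization_resolvent_form:
  assumes "realization n A b c G"
  shows "resolvent_form n A b c G" and "resolvent_form n (transpose_mat A) c b G"
proof -
  from assms have A: "A \<in> carrier_mat n n" and b: "b \<in> carrier_vec n" and c: "c \<in> carrier_vec n"
    by (auto simp: realization_def)
  have eig: "eigenvalue (cmat (transpose_mat A)) z \<longleftrightarrow> eigenvalue (cmat A) z" for z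
  proof -
    have "cmat (transpose_mat A) = transpose_mat (cmat A)" by (rule eq_matI) auto
    then show ?thesis
      using A by (simp add: eigenvalue_root_char_poly[of _ n])
  qed
  have main: "\<exists>N\<in>carrier_mat n n. (z \<cdot>\<^sub>m 1\<^sub>m n - cmat A) * N = 1\<^sub>m n \<and> N * (z \<cdot>\<^sub>m 1\<^sub>m n - cmat A) = 1\<^sub>m n \<and>
      G z = cvec c \<bullet> (N *\<^sub>v cvec b)" if z: "\<not> eigenvalue (cmat A) z" for z
  proof -
    have R: "z \<cdot>\<^sub>m 1\<^sub>m n - cmat A \<in> carrier_mat n n" using A by (simp add: minus_carrier_mat)
    obtain N where N: "mat_inverse (z \<cdot>\<^sub>m 1\<^sub>m n - cmat A) = Some N" "N \<in> carrier_mat n n"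
      "(z \<cdot>\<^sub>m 1\<^sub>m n - cmat A) * N = 1\<^sub>m n" "N * (z \<cdot>\<^sub>m 1\<^sub>m n - cmat A) = 1\<^sub>m n"
      using mat_inverse_of_det[OF R not_eigenvalue_det[OF _ z]] A by auto
    have "G z = cvec c \<bullet> (the (mat_inverse (z \<cdot>\<^sub>m 1\<^sub>m n - cmat A)) *\<^sub>v cvec b)"
      using assms z by (simp add: realization_def)
    then show ?thesis using N by auto
  qed
  show "resolvent_form n A b c G"
    unfolding resolvent_form_def
  proof (intro conjI allI impI A b c)
    fix z assume "\<not> eigenvalue (cmat A) z"
    then obtain N where N: "N \<in> carrier_mat n n" "(z \<cdot>\<^sub>m 1\<^sub>m n - cmat A) * N = 1\<^sub>m n"
      "G z = cvec c \<bullet> (N *\<^sub>v cvec b)"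
      using main by blast
    have "(z \<cdot>\<^sub>m 1\<^sub>m n - cmat A) *\<^sub>v (N *\<^sub>v cvec b) = cvec b"
      using assoc_mult_mat_vec[of "z \<cdot>\<^sub>m 1\<^sub>m n - cmat A" n n N n "cvec b"] N A b
      by (simp add: minus_carrier_mat)
    then show "\<exists>y\<in>carrier_vec n. (z \<cdot>\<^sub>m 1\<^sub>m n - cmat A) *\<^sub>v y = cvec b \<and> G z = cvec c \<bullet> y"
      using N b by (intro bexI[of _ "N *\<^sub>v cvec b"]) (auto intro: mult_mat_vec_carrier)
  qed
  show "resolvent_form n (transpose_mat A) c b G"
    unfolding resolvent_form_def eig
  proof (intro conjI allI impI b c)
    show "transpose_mat A \<in> carrier_mat n n" using A by simp
    fix z assume "\<not> eigenvalue (cmat A) z"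
    then obtain N where N: "N \<in> carrier_mat n n" "N * (z \<cdot>\<^sub>m 1\<^sub>m n - cmat A) = 1\<^sub>m n"
      "G z = cvec c \<bullet> (N *\<^sub>v cvec b)"
      using main by blast
    have T: "z \<cdot>\<^sub>m 1\<^sub>m n - cmat (transpose_mat A) = transpose_mat (z \<cdot>\<^sub>m 1\<^sub>m n - cmat A)"
      using A by (intro eq_matI) auto
    have "transpose_mat (z \<cdot>\<^sub>m 1\<^sub>m n - cmat A) * transpose_mat N = 1\<^sub>m n"
      using transpose_mult[of N n n "z \<cdot>\<^sub>m 1\<^sub>m n - cmat A" n] N A by (simp add: minus_carrier_mat)
    then have "(z \<cdot>\<^sub>m 1\<^sub>m n - cmat (transpose_mat A)) *\<^sub>v (transpose_mat N *\<^sub>v cvec c) = cvec c"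
      using assoc_mult_mat_vec[of "transpose_mat (z \<cdot>\<^sub>m 1\<^sub>m n - cmat A)" n n "transpose_mat N" n "cvec c"]
        N A c by (simp add: T minus_carrier_mat)
    moreover have "G z = cvec b \<bullet> (transpose_mat N *\<^sub>v cvec c)"
      using transpose_vec_mult_scalar[of N n n "cvec b" "cvec c"] N b c
        comm_scalar_prod[of "cvec b" n "transpose_mat N *\<^sub>v cvec c"]
      by (simp add: mult_mat_vec_carrier)
    ultimately show "\<exists>y\<in>carrier_vec n. (z \<cdot>\<^sub>m 1\<^sub>m n - cmat (transpose_mat A)) *\<^sub>v y = cvec c \<and>
        G z = cvec b \<bullet> y"
      using N c by (intro bexI[of _ "transpose_mat N *\<^sub>v cvec c"]) (auto intro!: mult_mat_vec_carrier[of _ n n])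
  qed
qed

lemma transfer_function_times_annihilator:
  assumes res: "resolvent_form n A b c G"
    and ann: "annihilates (\<lambda>r l. complex_of_real (krylov A b r l)) n P"
  obtains N where "\<And>z. \<not> eigenvalue (cmat A) z \<Longrightarrow> poly P z * G z = poly N z"
proof -
  let ?X = "\<lambda>r l. complex_of_real (krylov A b r l)"
  let ?M = "\<lambda>r m. complex_of_real (A $$ (r, m))"
  from res have A: "A \<in> carrier_mat n n" and b: "b \<in> carrier_vec n" and c: "c \<in> carrier_vec n"
    by (auto simp: resolvent_form_def)
  interpret linear_recursion n ?M ?X
  proof
    fix r l assume "r < n"
    then show "?X r (Suc l) = (\<Sum>m<n. ?M r m * ?X m l)"
      using linear_recursion.step[OF linear_recursion_krylov[OF A b]] by simp
  qed
  \<comment> \<open>\<open>N\<close> collects the right-hand sides of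
    \<open>resolvent_polynomial\<close>, which are polynomials in \<open>z\<close>, weighted by the
    entries of \<open>c\<close>.\<close>
  define N where "N = (\<Sum>r<n. smult (complex_of_real (c $ r))
    (\<Sum>i\<le>degree P. smult (coeff P i) (\<Sum>l<i. monom (?X r l) (i - Suc l))))"
  show ?thesis
  proof
    fix z assume z: "\<not> eigenvalue (cmat A) z"
    then obtain y where y: "y \<in> carrier_vec n" "(z \<cdot>\<^sub>m 1\<^sub>m n - cmat A) *\<^sub>v y = cvec b" "G z = cvec c \<bullet> y"
      using res by (auto simp: resolvent_form_def)
    have lin: "((z \<cdot>\<^sub>m 1\<^sub>m n - cmat A) *\<^sub>v w) $ r = z * w $ r - (\<Sum>m<n. ?M r m * w $ m)"
      if w: "w \<in> carrier_vec n" and r: "r < n" for w r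
    proof -
      have "((z \<cdot>\<^sub>m 1\<^sub>m n - cmat A) *\<^sub>v w) $ r = (\<Sum>m<n. ((if r = m then z else 0) - ?M r m) * w $ m)"
        using w r A by (auto simp: scalar_prod_def lessThan_atLeast0 intro!: sum.cong)
      also have "\<dots> = (\<Sum>m<n. (if r = m then z * w $ m else 0)) - (\<Sum>m<n. ?M r m * w $ m)"
        unfolding sum_subtractf[symmetric] by (intro sum.cong) (auto simp: left_diff_distrib)
      finally show ?thesis using r by simp
    qed
    have solves: "(\<Sum>m<n. ?M r m * y $ m) = z * y $ r - ?X r 0" if "r < n" for r
      using lin[OF y(1) that] y(2) that A b by (simp add: krylov_def)
    have regular: "\<forall>r<n. w r = 0" if w: "\<And>r. r < n \<Longrightarrow> (\<Sum>m<n. ?M r m * w m) = z * w r" for w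
    proof -
      have "(z \<cdot>\<^sub>m 1\<^sub>m n - cmat A) *\<^sub>v vec n w = 0\<^sub>v n"
      proof (rule eq_vecI)
        fix r assume "r < dim_vec (0\<^sub>v n :: complex vec)"
        then show "((z \<cdot>\<^sub>m 1\<^sub>m n - cmat A) *\<^sub>v vec n w) $ r = 0\<^sub>v n $ r"
          using lin[of "vec n w" r] w[of r] by simp
      qed (use A in simp)
      moreover have "det (z \<cdot>\<^sub>m 1\<^sub>m n - cmat A) \<noteq> 0"
        using not_eigenvalue_det[OF _ z, of n] A by simp
      moreover have "z \<cdot>\<^sub>m 1\<^sub>m n - cmat A \<in> carrier_mat n n"
        using A by (simp add: minus_carrier_mat)
      ultimately have "vec n w = 0\<^sub>v n"
        using det_0_iff_vec_prod_zero_field[of "z \<cdot>\<^sub>m 1\<^sub>m n - cmat A" n] vec_carrier[of n w] by blast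
      then show ?thesis by (auto simp: vec_eq_iff)
    qed
    have "poly P z * G z = (\<Sum>r<n. complex_of_real (c $ r) * (poly P z * y $ r))"
      using y c by (simp add: scalar_prod_def lessThan_atLeast0 sum_distrib_left mult_ac)
    also have "\<dots> = (\<Sum>r<n. complex_of_real (c $ r) *
        (\<Sum>i\<le>degree P. coeff P i * (\<Sum>l<i. z ^ (i - Suc l) * ?X r l)))"
      using resolvent_polynomial[OF ann regular solves] by simp
    also have "\<dots> = poly N z"
      by (simp add: N_def poly_sum poly_monom mult.commute)
    finally show "poly P z * G z = poly N z" .
  qed
qed

text \<open>With \<open>P G = N\<close> and \<open>G = g Z / Q\<close>, the identity
  \<open>g Z P = N Q\<close> holds off a finite set and so for polynomials; zeros and poles being
  disjoint, the whole of \<open>Q\<close> divides \<open>P\<close>.\<close>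

lemma poles_dvd_annihilator:
  assumes res: "resolvent_form n A b c G" and form: "pole_zero_form G g zs ps"
    and ann: "annihilates (\<lambda>r l. complex_of_real (krylov A b r l)) n P"
  shows "(\<Prod>a\<leftarrow>ps. [:- a, 1:]) dvd P"
proof -
  let ?Z = "\<Prod>a\<leftarrow>zs. [:- a, 1:]" and ?Q = "\<Prod>a\<leftarrow>ps. [:- a, 1:]"
  have eval: "poly (\<Prod>a\<leftarrow>as. [:- a, 1:]) z = (\<Prod>a\<leftarrow>as. z - a)" for as and z :: complex
    by (induction as) (auto simp: algebra_simps)
  obtain N where N: "\<And>z. \<not> eigenvalue (cmat A) z \<Longrightarrow> poly P z * G z = poly N z"
    using transfer_function_times_annihilator[OF res ann] by blast
  have A: "cmat A \<in> carrier_mat n n" using res by (simp add: resolvent_form_def)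
  define E where "E = {z. eigenvalue (cmat A) z} \<union> {z. G z \<noteq> g * (\<Prod>a\<leftarrow>zs. z - a) / (\<Prod>p\<leftarrow>ps. z - p)} \<union> set ps"
  have "finite {z. eigenvalue (cmat A) z}"
    using card_finite_spectrum(1)[OF A] by (simp add: spectrum_def)
  then have "finite E"
    using form by (simp add: E_def pole_zero_form_def)
  have "smult g ?Z * P - N * ?Q = 0"
  proof (rule ccontr)
    assume "smult g ?Z * P - N * ?Q \<noteq> 0"
    then have "finite {z. poly (smult g ?Z * P - N * ?Q) z = 0}" by (rule poly_roots_finite)
    moreover have "- E \<subseteq> {z. poly (smult g ?Z * P - N * ?Q) z = 0}"
    proof
      fix z assume "z \<in> - E"
      then have z: "\<not> eigenvalue (cmat A) z" "G z = g * (\<Prod>a\<leftarrow>zs. z - a) / (\<Prod>p\<leftarrow>ps. z - p)" "z \<notin> set ps"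
        by (auto simp: E_def)
      have "(\<Prod>p\<leftarrow>ps. z - p) \<noteq> 0" using z(3) by (auto simp: prod_list_zero_iff)
      then have "G z * (\<Prod>p\<leftarrow>ps. z - p) = g * (\<Prod>a\<leftarrow>zs. z - a)" using z(2) by simp
      then have "poly N z * (\<Prod>p\<leftarrow>ps. z - p) = poly P z * (g * (\<Prod>a\<leftarrow>zs. z - a))"
        unfolding N[OF z(1), symmetric] by (simp add: mult.assoc)
      then show "z \<in> {z. poly (smult g ?Z * P - N * ?Q) z = 0}"
        by (simp add: eval mult_ac)
    qed
    ultimately have "finite (- E)" by (rule rev_finite_subset)
    with \<open>finite E\<close> show False
      using infinite_UNIV_char_0[where ?'a = complex] by (simp add: Compl_eq_Diff_UNIV)
  qed
  then have "?Q dvd smult g ?Z * P" by simp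
  then show ?thesis
    by (rule linear_factors_dvd_cancel)
       (use form in \<open>auto simp: pole_zero_form_def eval prod_list_zero_iff\<close>)
qed

lemma indep_window_of_poles:
  assumes res: "resolvent_form n A b c G" and form: "pole_zero_form G g zs ps"
    and j: "j \<le> length ps" "\<And>a. a \<in> set (take j ps) \<Longrightarrow> a \<noteq> 0"
  shows "indep_window (krylov A b) n i j"
  unfolding indep_window_def
proof (intro allI impI)
  fix x a assume x: "\<forall>r<n. (\<Sum>a<j. krylov A b r (i + a) * x a) = 0" and a: "a < j"
  define p where "p = seq_poly j (\<lambda>a. complex_of_real (x a))"
  have comb: "seq_comb (\<lambda>r l. complex_of_real (krylov A b r l)) (monom 1 i * p) r =
      complex_of_real (\<Sum>a<j. krylov A b r (i + a) * x a)" for r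
    by (simp add: p_def seq_comb_seq_poly)
  have "annihilates (\<lambda>r l. complex_of_real (krylov A b r l)) n (monom 1 i * p)"
    unfolding annihilates_def comb
  proof (intro allI impI)
    fix r assume "r < n"
    then have "(\<Sum>a<j. krylov A b r (i + a) * x a) = 0" using x by blast
    then show "complex_of_real (\<Sum>a<j. krylov A b r (i + a) * x a) = 0" by (simp only: of_real_0)
  qed
  then have "(\<Prod>a\<leftarrow>take j ps @ drop j ps. [:- a, 1:]) dvd monom 1 i * p"
    unfolding append_take_drop_id by (rule poles_dvd_annihilator[OF res form])
  then have "(\<Prod>a\<leftarrow>take j ps. [:- a, 1:]) * (\<Prod>a\<leftarrow>drop j ps. [:- a, 1:]) dvd monom 1 i * p"
    by (simp only: map_append prod_list.append)
  then have "(\<Prod>a\<leftarrow>take j ps. [:- a, 1:]) dvd monom 1 i * p"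
    by (rule dvd_mult_left)
  \<comment> \<open>\<open>monom 1 i\<close> has no root other than 0, and the first
    \<open>j\<close> poles are nonzero.\<close>
  then have dvd: "(\<Prod>a\<leftarrow>take j ps. [:- a, 1:]) dvd p"
    by (rule linear_factors_dvd_cancel) (use j(2) in \<open>auto simp: poly_monom\<close>)
  have "degree (\<Prod>a\<leftarrow>take j ps. [:- a, 1:]) = j"
    using degree_linear_factors[of uminus "take j ps"] j(1) by simp
  moreover have "degree p < j"
    unfolding p_def by (rule degree_lessI) (use a in \<open>auto simp: coeff_seq_poly\<close>)
  ultimately have "p = 0"
    using dvd_imp_degree_le[OF dvd] by auto
  then have "coeff p a = 0" by simp
  then show "x a = 0"
    using a by (simp add: p_def coeff_seq_poly)
qed

section \<open>Positivity of both matrices, and the rank conditions from the poles\<close>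

theorem theorem3p1:
  fixes K k :: nat and A :: "real mat" and b c :: "real vec" and G :: "complex \<Rightarrow> complex"
  assumes "1 \<le> K" and "1 \<le> k" and "k \<le> K"
    and "realization K A b c G"
    and "k_positive k A"
  shows
    "((\<forall>j\<in>{1..k}. nonneg_mat (compound_mat j (ctrb_mat j A b))) \<and>
      (\<forall>j\<in>{1..k - 1}. vec_space.rank K (A ^\<^sub>m (K - j) * ctrb_mat j A b) = j) \<longrightarrow>
      (\<forall>t\<ge>k. k_positive k (ctrb_mat t A b))) \<and>
     ((\<forall>j\<in>{1..k}. nonneg_mat (compound_mat j (obsv_mat j A c))) \<and>
      (\<forall>j\<in>{1..k - 1}. vec_space.rank j (obsv_mat j A c * A ^\<^sub>m (K - j)) = j) \<longrightarrow>
      (\<forall>t\<ge>k. k_positive k (obsv_mat t A c))) \<and>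
     (\<forall>r zs ps. pole_zero_form G r zs ps \<and> k \<le> length ps \<and>
        (2 \<le> k \<longrightarrow> ps ! (k - 2) \<in> \<real> \<and> 0 < Re (ps ! (k - 2))) \<longrightarrow>
        (\<forall>j\<in>{1..k - 1}. vec_space.rank K (A ^\<^sub>m (K - j) * ctrb_mat j A b) = j) \<and>
        (\<forall>j\<in>{1..k - 1}. vec_space.rank j (obsv_mat j A c * A ^\<^sub>m (K - j)) = j))"
proof -
  have A: "A \<in> carrier_mat K K" and b: "b \<in> carrier_vec K" and c: "c \<in> carrier_vec K"
    using assms(4) by (auto simp: realization_def)
  have AT: "transpose_mat A \<in> carrier_mat K K" using A by simp
  have rank: "vec_space.rank K (A ^\<^sub>m (K - j) * ctrb_mat j A b) = j \<and>
      vec_space.rank j (obsv_mat j A c * A ^\<^sub>m (K - j)) = j"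
    if form: "pole_zero_form G r zs ps" and k: "k \<le> length ps"
      and pole: "2 \<le> k \<longrightarrow> ps ! (k - 2) \<in> \<real> \<and> 0 < Re (ps ! (k - 2))"
      and j: "j \<in> {1..k - 1}" for r zs ps j
  proof -
    from j have "2 \<le> k" by auto
    \<comment> \<open>Counting from 0, \<open>ps ! (k - 2)\<close> is the pole
      \<open>p_(k-1)\<close>. The poles before it are at least as large in modulus, hence nonzero
      too; \<open>j \<le> k - 1\<close> keeps the indices in this range.\<close>
    have nonzero: "a \<noteq> 0" if a: "a \<in> set (take j ps)" for a
    proof -
      obtain i where i: "i < j" "a = ps ! i"
        using a by (auto simp: in_set_conv_nth)
      have "ps ! (k - 2) \<noteq> 0" using pole \<open>2 \<le> k\<close> by auto
      moreover have "cmod (ps ! (k - 2)) \<le> cmod (ps ! i)"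
      proof (cases "i = k - 2")
        case False
        then have "i < k - 2" "k - 2 < length ps" using i j k by auto
        then show ?thesis
          using form sorted_wrt_nth_less[of _ ps i "k - 2"] by (fastforce simp: pole_zero_form_def)
      qed simp
      ultimately show ?thesis using i(2) by auto
    qed
    have "j \<le> length ps" using j k by auto
    \<comment> \<open>The observability condition is the same statement for the transposed
      triple.\<close>
    then have "indep_window (krylov A b) K (K - j) j"
      "indep_window (krylov (transpose_mat A) c) K (K - j) j"
      using indep_window_of_poles[OF _ form] realization_resolvent_form[OF assms(4)] nonzero by blast+
    then show ?thesis
      by (simp add: rank_obsv_iff[OF A c] rank_ctrb_iff[OF A b] rank_ctrb_iff[OF AT c])
  qed
  show ?thesis
    using ctrb_mat_k_positive[OF A b assms(3,5)] obsv_mat_k_positive[OF A c assms(3,5)] rank by blast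
qed

end
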